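(* Let $f:\mathbb{R}^2\to\mathbb{R}$ be a homogeneous polynomial of degree $p\geq 1$. Let $\mathcal{S}(f)=\{h\in\mathcal{D}(\mathbb{R}^2) : f\circ h=f\}$, where $\mathcal{D}(\mathbb{R}^2)$ is the group of $C^\infty$-diffeomorphisms of $\mathbb{R}^2$, and for $0\le r\le\infty$ let $\mathcal{S}_{\mathrm{id}}(f)^{r}$ be the identity component of $\mathcal{S}(f)$ with respect to the weak Whitney $C^r_W$-topology. Then $$\mathcal{S}_{\mathrm{id}}(f)^{\infty}=\cdots=\mathcal{S}_{\mathrm{id}}(f)^{r}=\cdots=\mathcal{S}_{\mathrm{id}}(f)^{1}\qquad\text{(for all } 1\le r\le \infty).$$ Moreover, $\mathcal{S}_{\mathrm{id}}(f)^{1}\neq\mathcal{S}_{\mathrm{id}}(f)^{0}$ if and only if $f$ is a product of at least two distinct definite quadratic forms, i.e. $f=\pm Q_1^{\beta_1}\cdots Q_k^{\beta_k}$ with $k\geq 2$, where the $Q_j$ are positive definite quadratic forms, $\beta_j\ge 1$, and $Q_j/Q_{j'}$ is not constant for $j\neq j'$.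
   Context: The identity component $\mathcal{S}_{\mathrm{id}}(f)^{r}$ is the path component of $\mathrm{id}_{\mathbb{R}^2}$: it consists of those $h\in\mathcal{S}(f)$ for which there is a homotopy $H:\mathbb{R}^2\times[0,1]\to\mathbb{R}^2$ with $H_0=\mathrm{id}_{\mathbb{R}^2}$, $H_1=h$, $H_t\in\mathcal{S}(f)$ for all $t\in[0,1]$, and such that all partial derivatives of $H(x,y,t)$ in the variables $(x,y)$ of order at most $r$ (of all orders if $r=\infty$) depend continuously on $(x,y,t)$. Equivalently, $t\mapsto H_t$ is a continuous path in the $C^r_W$-topology. Every (nonzero) homogeneous polynomial $f$ of degree $p\ge1$ on $\mathbb{R}^2$ can be written, up to sign, as $f=\pm\prod_{i=1}^{l}L_i^{\alpha_i}\cdot\prod_{j=1}^{k}Q_j^{\beta_j}$ with $L_i$ linear forms, $Q_j$ positive definite quadratic forms, $\alpha_i,\beta_j\ge1$, the $L_i$ pairwise non-proportional and the $Q_j$ pairwise non-proportional. "Distinct" quadratic forms means non-proportional ones. *)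

theory Defs
  imports "HOL-Analysis.Analysis" "HOL-Library.Extended_Nat"
begin

primrec C_k :: "nat \<Rightarrow> ('a::real_normed_vector \<Rightarrow> 'b::real_normed_vector) \<Rightarrow> bool" where
  "C_k 0 g \<longleftrightarrow> continuous_on UNIV g"
| "C_k (Suc k) g \<longleftrightarrow>
     (\<forall>z. g differentiable (at z)) \<and> (\<forall>v. C_k k (\<lambda>z. frechet_derivative g (at z) v))"

definition smooth :: "('a::real_normed_vector \<Rightarrow> 'b::real_normed_vector) \<Rightarrow> bool" where
  "smooth g \<longleftrightarrow> (\<forall>k. C_k k g)"

definition diffeos :: "(real^2 \<Rightarrow> real^2) set" where
  "diffeos = {h. bij h \<and> smooth h \<and> smooth (inv h)}"

definition stabilizer :: "(real^2 \<Rightarrow> real) \<Rightarrow> (real^2 \<Rightarrow> real^2) set" where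
  "stabilizer f = {h \<in> diffeos. f \<circ> h = f}"

text \<open>The list records the variables with respect to which one differentiates, so its length is
  the order of the partial derivative. Values are meaningful only for maps that are sufficiently
  often differentiable; below only smooth maps occur as arguments.\<close>

primrec iter_partial :: "2 list \<Rightarrow> (real^2 \<Rightarrow> real^2) \<Rightarrow> real^2 \<Rightarrow> real^2" where
  "iter_partial [] g = g"
| "iter_partial (i # w) g = (\<lambda>z. frechet_derivative (iter_partial w g) (at z) (axis i 1))"

text \<open>The path component of the identity for the weak Whitney $C^r$-topology: a continuous path in
  that topology is a homotopy whose partial derivatives of order at most \<open>r\<close> in the space variables
  are jointly continuous in space and time. For \<open>r = \<infinity>\<close> the condition on the order is vacuous.\<close>

definition stabilizer_id :: "(real^2 \<Rightarrow> real) \<Rightarrow> enat \<Rightarrow> (real^2 \<Rightarrow> real^2) set" where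
  "stabilizer_id f r = {h \<in> stabilizer f. \<exists>H :: real \<Rightarrow> real^2 \<Rightarrow> real^2.
     H 0 = id \<and> H 1 = h \<and> (\<forall>t\<in>{0..1}. H t \<in> stabilizer f) \<and>
     (\<forall>w. enat (length w) \<le> r \<longrightarrow>
        continuous_on (UNIV \<times> {0..1}) (\<lambda>(z, t). iter_partial w (H t) z))}"

text \<open>Since \<open>f\<close> is to have degree \<open>p\<close>, the zero polynomial is excluded.\<close>

definition homogeneous_poly :: "nat \<Rightarrow> (real^2 \<Rightarrow> real) \<Rightarrow> bool" where
  "homogeneous_poly p f \<longleftrightarrow> (\<exists>a :: nat \<Rightarrow> real. (\<exists>i\<le>p. a i \<noteq> 0) \<and>
     (\<forall>z. f z = (\<Sum>i\<le>p. a i * (z $ 1) ^ i * (z $ 2) ^ (p - i))))"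

definition pos_def_form :: "(real^2 \<Rightarrow> real) \<Rightarrow> bool" where
  "pos_def_form Q \<longleftrightarrow> homogeneous_poly 2 Q \<and> (\<forall>z. z \<noteq> 0 \<longrightarrow> Q z > 0)"

definition prod_distinct_definite :: "(real^2 \<Rightarrow> real) \<Rightarrow> bool" where
  "prod_distinct_definite f \<longleftrightarrow>
     (\<exists>(k::nat) (Q :: nat \<Rightarrow> real^2 \<Rightarrow> real) (\<beta> :: nat \<Rightarrow> nat) (s::real).
        k \<ge> 2 \<and> s \<in> {1, -1} \<and>
        (\<forall>j<k. pos_def_form (Q j) \<and> \<beta> j \<ge> 1) \<and>
        (\<forall>i<k. \<forall>j<k. i \<noteq> j \<longrightarrow> \<not> (\<lambda>z. Q i z / Q j z) constant_on (UNIV - {0})) \<and>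
        (\<forall>z. f z = s * (\<Prod>j<k. Q j z ^ \<beta> j)))"

end

theory Submission
  imports Defs "HOL-Complex_Analysis.Winding_Numbers" "HOL-Computational_Algebra.Field_as_Ring"
    "HOL-Computational_Algebra.Polynomial_Factorial" "HOL-Computational_Algebra.Fundamental_Theorem_Algebra"
begin

text \<open>For \<open>h\<close> preserving \<open>f\<close>, expanding \<open>h\<inverse>\<close> to first order at \<open>w = h 0\<close> shows that the polynomial
  \<open>s \<mapsto> f (s w + v)\<close> is bounded, so \<open>f\<close> is invariant under translation along \<open>w\<close>, and \<open>h\<close> may be moved to a
  map fixing the origin. Homogeneity then makes \<open>h (t z) / t\<close> an isotopy within the stabilizer which is continuous
  in every \<open>C\<^sup>r\<close>-topology and ends at the linear part \<open>D h(0)\<close>. Since the linear parts of a \<open>C\<^sup>1\<close>-path form a path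
  of linear maps, everything is reduced to the linear stabilizer of \<open>f\<close>.

  A linear map reached from the identity by a \<open>C\<^sup>0\<close>-path has positive determinant and preserves each ray of zeros
  of \<open>f\<close>. If there is such a ray, its eigenvalues are positive and it lies on a one-parameter group of
  invariant linear maps; if \<open>f\<close> is a power of a definite quadratic form, it is a rotation up to conjugation. For a
  product of several definite forms, \<open>-id\<close> is reached by rotating along the level curves of \<open>f\<close>, with
  an angle that vanishes near the origin. It is not reached by linear maps, because these act on the upper half plane
  by Moebius maps fixing the at least two roots of \<open>f\<close>.\<close>

section \<open>Calculus of finitely often differentiable maps\<close>

text \<open>The obstacle is that a C^0-path gives no control of derivatives, so the linear parts
  along it need not vary continuously. Only topological data survive: the winding number of the
  image of the unit circle, and the zero directions, which cannot move because there are only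
  finitely many. Hence the proof takes the linear part of the endpoint alone and shows that these
  data already put it into the identity component of the linear stabilizer, unless \<open>f\<close>
  has at least two definite factors. For such a product the data do not exclude \<open>-id\<close>.
  Turning along the level curves preserves \<open>f\<close> but is not smooth at the origin, so the
  angle is made a function of \<open>f z\<close> that vanishes on a neighbourhood of the origin.
  This neighbourhood shrinks to a point as the path ends. All stages are diffeomorphisms; before the
  final time their derivative at the origin is the identity, then it jumps to \<open>-id\<close>,
  and a C^0-topology does not see this jump.\<close>

primrec C_k_on :: "nat \<Rightarrow> 'a set \<Rightarrow> ('a::real_normed_vector \<Rightarrow> 'b::real_normed_vector) \<Rightarrow> bool" where
  "C_k_on 0 S g \<longleftrightarrow> continuous_on S g"
| "C_k_on (Suc k) S g \<longleftrightarrow>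
     (\<forall>z\<in>S. g differentiable (at z)) \<and> (\<forall>v. C_k_on k S (\<lambda>z. frechet_derivative g (at z) v))"

lemma C_k_eq_C_k_on: "C_k k g \<longleftrightarrow> C_k_on k UNIV g"
  by (induction k arbitrary: g) auto

text \<open>A derivative \<open>at z\<close> sees a full neighbourhood of \<open>z\<close>; as
  \<open>S\<close> is open, it depends only on the values in \<open>S\<close>.\<close>

lemma C_k_on_cong:
  assumes "open S" "\<And>z. z \<in> S \<Longrightarrow> g z = g' z"
  shows "C_k_on k S g \<longleftrightarrow> C_k_on k S g'"
  using assms(2)
proof (induction k arbitrary: g g')
  case 0
  then show ?case by (simp cong: continuous_on_cong)
next
  case (Suc k)
  have hd: "(g has_derivative D) (at z) \<longleftrightarrow> (g' has_derivative D) (at z)" if "z \<in> S" for z D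
    using has_derivative_transform_within_open[OF _ assms(1) that, of g D UNIV g']
      has_derivative_transform_within_open[OF _ assms(1) that, of g' D UNIV g] Suc.prems by metis
  have "g differentiable (at z) \<longleftrightarrow> g' differentiable (at z)" if "z \<in> S" for z
    using hd[OF that] by (simp add: differentiable_def)
  moreover have "frechet_derivative g (at z) = frechet_derivative g' (at z)" if "z \<in> S" for z
    using hd[OF that] by (simp add: frechet_derivative_def)
  then have "C_k_on k S (\<lambda>z. frechet_derivative g (at z) v) \<longleftrightarrow>
      C_k_on k S (\<lambda>z. frechet_derivative g' (at z) v)" for v
    by (intro Suc.IH) simp
  ultimately show ?case by simp
qed

text \<open>Uniqueness of derivatives lets an explicit \<open>g'\<close> replace the choice-based
  \<open>frechet_derivative\<close>.\<close>

lemma C_k_on_SucI: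
  assumes "open S" "\<And>z. z \<in> S \<Longrightarrow> (g has_derivative g' z) (at z)"
    "\<And>v. C_k_on k S (\<lambda>z. g' z v)"
  shows "C_k_on (Suc k) S g"
proof -
  have "C_k_on k S (\<lambda>z. frechet_derivative g (at z) v)" for v
    using assms(3)[of v] C_k_on_cong[OF assms(1), of "\<lambda>z. frechet_derivative g (at z) v" "\<lambda>z. g' z v" k]
      frechet_derivative_at[OF assms(2)] by metis
  then show ?thesis using assms(2) by (auto simp: differentiable_def)
qed

lemma C_k_on_SucD:
  assumes "C_k_on (Suc k) S g" "z \<in> S"
  shows "(g has_derivative frechet_derivative g (at z)) (at z)"
  using assms by (auto simp: frechet_derivative_works)

lemma C_k_on_Suc_imp: "C_k_on (Suc k) S g \<Longrightarrow> C_k_on k S g"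
proof (induction k arbitrary: g)
  case 0
  then show ?case
    by (auto intro!: continuous_at_imp_continuous_on differentiable_imp_continuous_within)
next
  case (Suc k)
  then show ?case by (metis C_k_on.simps(2))
qed

lemma C_k_on_imp_continuous: "C_k_on k S g \<Longrightarrow> continuous_on S g"
  by (induction k) (use C_k_on_Suc_imp in \<open>auto simp only: C_k_on.simps(1)\<close>)

lemma C_k_on_const: "open S \<Longrightarrow> C_k_on k S (\<lambda>z. c)"
proof (induction k arbitrary: c)
  case (Suc k)
  then show ?case by (intro C_k_on_SucI[where g'="\<lambda>_ _. 0"]) simp_all
qed simp

lemma C_k_on_bounded_linear: "open S \<Longrightarrow> bounded_linear A \<Longrightarrow> C_k_on k S A"
proof (cases k)
  case (Suc m)
  assume "open S" "bounded_linear A"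
  then show ?thesis unfolding Suc
    by (intro C_k_on_SucI[where g'="\<lambda>_. A"] C_k_on_const bounded_linear_imp_has_derivative)
qed (simp add: linear_continuous_on)

lemma C_k_on_nth: "open S \<Longrightarrow> C_k_on k S (\<lambda>z::real^'n. z $ i)"
  by (rule C_k_on_bounded_linear[OF _ bounded_linear_vec_nth])

lemma C_k_on_add:
  assumes "open S"
  shows "C_k_on k S g \<Longrightarrow> C_k_on k S h \<Longrightarrow> C_k_on k S (\<lambda>z. g z + h z)"
proof (induction k arbitrary: g h)
  case (Suc k)
  show ?case
  proof (rule C_k_on_SucI[OF assms])
    show "((\<lambda>z. g z + h z) has_derivative
        (\<lambda>v. frechet_derivative g (at z) v + frechet_derivative h (at z) v)) (at z)" if "z \<in> S" for z
      by (intro has_derivative_add C_k_on_SucD[OF Suc.prems(1) that] C_k_on_SucD[OF Suc.prems(2) that])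
    show "C_k_on k S (\<lambda>z. frechet_derivative g (at z) v + frechet_derivative h (at z) v)" for v
      using Suc.prems by (intro Suc.IH) simp_all
  qed
qed (auto intro: continuous_intros)

lemma (in bounded_bilinear) C_k_on:
  assumes "open S"
  shows "C_k_on k S g \<Longrightarrow> C_k_on k S h \<Longrightarrow> C_k_on k S (\<lambda>z. prod (g z) (h z))"
proof (induction k arbitrary: g h)
  case (Suc k)
  have "C_k_on k S g" "C_k_on k S h" using Suc.prems C_k_on_Suc_imp by blast+
  show ?case
  proof (rule C_k_on_SucI[OF assms])
    show "((\<lambda>z. prod (g z) (h z)) has_derivative (\<lambda>v. prod (g z) (frechet_derivative h (at z) v) +
        prod (frechet_derivative g (at z) v) (h z))) (at z)" if "z \<in> S" for z
      by (intro FDERIV C_k_on_SucD[OF Suc.prems(1) that] C_k_on_SucD[OF Suc.prems(2) that])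
    show "C_k_on k S (\<lambda>z. prod (g z) (frechet_derivative h (at z) v) +
        prod (frechet_derivative g (at z) v) (h z))" for v
      using Suc.prems \<open>C_k_on k S g\<close> \<open>C_k_on k S h\<close> by (intro C_k_on_add Suc.IH assms) simp_all
  qed
qed (auto intro: continuous_on)

lemmas C_k_on_mult = bounded_bilinear.C_k_on[OF bounded_bilinear_mult]
lemmas C_k_on_scaleR = bounded_bilinear.C_k_on[OF bounded_bilinear_scaleR]

lemma C_k_on_power: "open S \<Longrightarrow> C_k_on k S g \<Longrightarrow> C_k_on k S (\<lambda>z. g z ^ n :: 'b :: real_normed_algebra_1)"
  by (induction n) (simp_all add: C_k_on_mult C_k_on_const)

lemma C_k_on_sum: "open S \<Longrightarrow> (\<And>i. i \<in> I \<Longrightarrow> C_k_on k S (g i)) \<Longrightarrow> C_k_on k S (\<lambda>z. \<Sum>i\<in>I. g i z)"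
  by (induction I rule: infinite_finite_induct) (simp_all add: C_k_on_add C_k_on_const)

text \<open>The reason for localizing \<open>C_k\<close> to sets: a map with one smooth description
  near the origin and another away from it can be treated on each open piece.\<close>

lemma C_k_on_Un: "open S \<Longrightarrow> open T \<Longrightarrow> C_k_on k S g \<Longrightarrow> C_k_on k T g \<Longrightarrow> C_k_on k (S \<union> T) g"
proof (induction k arbitrary: g)
  case 0
  then show ?case by (simp add: continuous_on_open_Un)
next
  case (Suc k)
  then show ?case by (simp add: ball_Un)
qed

text \<open>With a real variable in between, the derivative of \<open>F\<close> is multiplication by
  a number, so the chain rule yields a product and the induction needs only \<open>F\<close> to
  vary.\<close>

lemma C_k_on_compose_real:
  fixes F :: "real \<Rightarrow> real" and u :: "'a::real_normed_vector \<Rightarrow> real"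
  assumes "open S" "u ` S \<subseteq> T"
  shows "C_k_on k T F \<Longrightarrow> C_k_on k S u \<Longrightarrow> C_k_on k S (\<lambda>z. F (u z))"
proof (induction k arbitrary: F)
  case 0
  then show ?case using assms continuous_on_compose2[of T F S u] by auto
next
  case (Suc k)
  have F: "(F has_derivative frechet_derivative F (at x)) (at x)" if "x \<in> T" for x
    using Suc.prems(1) that C_k_on_SucD by blast
  have lin: "frechet_derivative F (at x) y = y * frechet_derivative F (at x) 1" if "x \<in> T" for x y
    using linear_scale[OF has_derivative_linear[OF F[OF that]], of y 1] by simp
  have "C_k_on (Suc k) S (F \<circ> u)"
  proof (rule C_k_on_SucI[OF assms(1)])
    fix z assume z: "z \<in> S"
    then have "u z \<in> T" using assms by auto
    with F have "(F has_derivative frechet_derivative F (at (u z))) (at (u z))" by blast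
    from diff_chain_at[OF C_k_on_SucD[OF Suc.prems(2) z] this]
    have "(F \<circ> u has_derivative (frechet_derivative F (at (u z)) \<circ> frechet_derivative u (at z))) (at z)" .
    moreover have "frechet_derivative F (at (u z)) \<circ> frechet_derivative u (at z)
       = (\<lambda>v. frechet_derivative u (at z) v * frechet_derivative F (at (u z)) 1)"
      unfolding o_def by (rule ext) (rule lin[OF \<open>u z \<in> T\<close>])
    ultimately show "(F \<circ> u has_derivative (\<lambda>v. frechet_derivative u (at z) v * frechet_derivative F (at (u z)) 1)) (at z)"
      by simp
  next
    fix v
    have "C_k_on k S (\<lambda>z. frechet_derivative F (at (u z)) 1)"
      by (rule Suc.IH) (use Suc.prems(1) C_k_on_Suc_imp[OF Suc.prems(2)] in simp_all)
    with Suc.prems(2) show "C_k_on k S (\<lambda>z. frechet_derivative u (at z) v * frechet_derivative F (at (u z)) 1)"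
      by (intro C_k_on_mult[OF assms(1)]) simp_all
  qed
  then show ?case by (simp add: comp_def)
qed

section \<open>Elementary functions of one real variable\<close>

lemma C_k_on_real_derivI:
  fixes F :: "real \<Rightarrow> real"
  assumes "open T" "\<And>x. x \<in> T \<Longrightarrow> (F has_field_derivative F' x) (at x)" "C_k_on k T F'"
  shows "C_k_on (Suc k) T F"
proof (rule C_k_on_SucI[OF assms(1)])
  show "(F has_derivative (\<lambda>v. v * F' z)) (at z)" if "z \<in> T" for z
    using assms(2)[OF that] by (simp add: has_field_derivative_def mult_commute_abs)
  show "C_k_on k T (\<lambda>z. v * F' z)" for v
    using C_k_on_mult[OF assms(1) C_k_on_const[OF assms(1)] assms(3)] .
qed

lemma C_k_on_cos_sin: "C_k_on k UNIV (cos :: real \<Rightarrow> real) \<and> C_k_on k UNIV (sin :: real \<Rightarrow> real)"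
proof (induction k)
  case 0
  show ?case by (simp add: continuous_on_cos continuous_on_sin)
next
  case (Suc k)
  have "C_k_on k UNIV (\<lambda>x::real. - 1 * sin x)"
    using Suc by (intro C_k_on_mult C_k_on_const) simp_all
  then have "C_k_on k UNIV (\<lambda>x::real. - sin x)" by simp
  then have "C_k_on (Suc k) UNIV (cos :: real \<Rightarrow> real)"
    by (rule C_k_on_real_derivI[OF open_UNIV DERIV_cos])
  moreover have "C_k_on (Suc k) UNIV (sin :: real \<Rightarrow> real)"
    using Suc by (intro C_k_on_real_derivI[OF open_UNIV DERIV_sin]) simp
  ultimately show ?case by simp
qed

lemma C_k_on_powr: "C_k_on k {0<..} (\<lambda>x::real. x powr a)"
proof (induction k arbitrary: a)
  case 0
  show ?case
    unfolding C_k_on.simps by (intro continuous_on_powr continuous_on_id continuous_on_const) simp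
next
  case (Suc k)
  show ?case
  proof (rule C_k_on_real_derivI)
    show "((\<lambda>x. x powr a) has_field_derivative a * x powr (a - 1)) (at x)" if "x \<in> {0<..}" for x
      using that by (intro has_real_derivative_powr) simp
    show "C_k_on k {0<..} (\<lambda>x. a * x powr (a - 1))"
      by (rule C_k_on_mult[OF _ C_k_on_const Suc]) simp_all
  qed simp
qed

text \<open>The classical flat function is the case \<open>m = 0\<close>. The extra powers of
  \<open>1 / x\<close> make the family closed under differentiation up to linear combinations, so
  smoothness is an induction over all \<open>m\<close> at once.\<close>

definition flat_exp :: "nat \<Rightarrow> real \<Rightarrow> real" where
  "flat_exp m x = (if x > 0 then inverse x ^ m * exp (- inverse x) else 0)"

text \<open>The upper bound keeps a single term of the exponential series at
  \<open>y = 1 / x\<close>, the one of order \<open>m + 2\<close>. A quadratic bound makes the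
  difference quotient at 0 vanish.\<close>

lemma flat_exp_bounds: "0 \<le> flat_exp m x" "flat_exp m x \<le> fact (m + 2) * x\<^sup>2"
proof -
  show "0 \<le> flat_exp m x" by (simp add: flat_exp_def)
  show "flat_exp m x \<le> fact (m + 2) * x\<^sup>2"
  proof (cases "x > 0")
    case True
    define y where "y = inverse x"
    have y: "y > 0" "x = inverse y" using True by (auto simp: y_def)
    have "inverse (fact (m + 2)) * y ^ (m + 2) \<le> exp y"
      using sum_le_suminf[OF summable_exp, of "{m+2}" y] y(1)
      by (simp add: exp_def divide_inverse_commute del: fact_Suc power_Suc)
    then have "y ^ (m + 2) / fact (m + 2) \<le> exp y"
      by (simp only: divide_inverse_commute)
    then have "y ^ (m + 2) \<le> exp y * fact (m + 2)"
      by (subst (asm) pos_divide_le_eq) (rule fact_gt_zero)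
    then have "y ^ m * y\<^sup>2 \<le> fact (m + 2) * exp y"
      by (simp only: power_add mult.commute)
    then have "y ^ m * y\<^sup>2 * (exp (- y) * (inverse y)\<^sup>2) \<le> fact (m + 2) * exp y * (exp (- y) * (inverse y)\<^sup>2)"
      by (rule mult_right_mono) simp
    moreover have "y ^ m * y\<^sup>2 * (exp (- y) * (inverse y)\<^sup>2) = y ^ m * exp (- y) * (y * inverse y)\<^sup>2"
      by (simp only: power_mult_distrib mult_ac)
    moreover have "fact (m + 2) * exp y * (exp (- y) * (inverse y)\<^sup>2) = fact (m + 2) * (inverse y)\<^sup>2 * (exp y * exp (- y))"
      by (simp only: mult_ac)
    moreover have "y * inverse y = 1" "exp y * exp (- y) = 1"
      using y(1) by (simp_all add: exp_minus)
    ultimately have "y ^ m * exp (- y) \<le> fact (m + 2) * (inverse y)\<^sup>2"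
      by (simp only: power_one mult_1_right)
    then show ?thesis using True y by (simp add: flat_exp_def del: fact_Suc)
  qed (simp add: flat_exp_def)
qed

lemma flat_exp_deriv:
  "(flat_exp m has_field_derivative (flat_exp (m + 2) x - m * flat_exp (m + 1) x)) (at x)"
proof -
  consider "x > 0" | "x < 0" | "x = 0" by linarith
  then show ?thesis
  proof cases
    case 1
    have "((\<lambda>x. inverse x ^ m * exp (- inverse x)) has_field_derivative
        (flat_exp (m + 2) x - m * flat_exp (m + 1) x)) (at x)"
      using 1 
      by (auto intro!: derivative_eq_intros simp: flat_exp_def) (cases m; simp add: algebra_simps)
    then show ?thesis
      by (rule has_field_derivative_transform_within_open[where S="{0<..}"]) (use 1 in \<open>auto simp: flat_exp_def\<close>)
  next
    case 2
    have "((\<lambda>x. 0) has_field_derivative (flat_exp (m + 2) x - m * flat_exp (m + 1) x)) (at x)"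
      using 2 by (auto simp: flat_exp_def)
    then show ?thesis
      by (rule has_field_derivative_transform_within_open[where S="{..<0}"]) (use 2 in \<open>auto simp: flat_exp_def\<close>)
  next
    case 3
    have "((\<lambda>h. flat_exp m h / h) \<longlongrightarrow> 0) (at 0)"
    proof (rule Lim_null_comparison)
      show "\<forall>\<^sub>F h in at 0. norm (flat_exp m h / h) \<le> fact (m + 2) * \<bar>h\<bar>"
      proof (rule always_eventually, rule allI)
        fix h :: real
        show "norm (flat_exp m h / h) \<le> fact (m + 2) * \<bar>h\<bar>"
          using flat_exp_bounds[of m h] by (cases "h = 0") (auto simp: power2_eq_square field_simps abs_mult simp del: fact_Suc)
      qed
      show "((\<lambda>h::real. fact (m + 2) * \<bar>h\<bar>) \<longlongrightarrow> 0) (at 0)"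
        by (auto intro!: tendsto_eq_intros)
    qed
    then show ?thesis using 3 by (simp add: DERIV_def flat_exp_def)
  qed
qed

lemma C_k_on_flat_exp: "C_k_on k UNIV (flat_exp m)"
proof (induction k arbitrary: m)
  case 0
  show ?case
    using DERIV_isCont[OF flat_exp_deriv] by (auto intro!: continuous_at_imp_continuous_on)
next
  case (Suc k)
  have "C_k_on k UNIV (\<lambda>x. flat_exp (m + 2) x + (- m) * flat_exp (m + 1) x)"
    by (intro C_k_on_add C_k_on_mult C_k_on_const Suc open_UNIV)
  then show ?case
    by (intro C_k_on_real_derivI[where F' = "\<lambda>x. flat_exp (m + 2) x - m * flat_exp (m + 1) x"])
      (use flat_exp_deriv in simp_all)
qed

section \<open>Isotopies\<close>

lemma vec2_expand: "z = z $ 1 *\<^sub>R axis 1 1 + z $ 2 *\<^sub>R axis 2 (1::real)" for z :: "real^2"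
  by (simp add: vec_eq_iff forall_2 axis_def)

lemma linear_vec2: "linear A \<Longrightarrow> A z = z $ 1 *\<^sub>R A (axis 1 1) + z $ 2 *\<^sub>R A (axis 2 1)" for z :: "real^2"
  by (subst vec2_expand[of z]) (simp only: linear_add linear_scale)

section \<open>Smooth maps of the plane and their partial derivatives\<close>

lemma smooth_linear: "linear A \<Longrightarrow> smooth A" for A :: "real^2 \<Rightarrow> real^2"
  unfolding smooth_def C_k_eq_C_k_on by (simp add: C_k_on_bounded_linear linear_linear)

lemma smooth_differentiable: "smooth g \<Longrightarrow> g differentiable (at z)"
  unfolding smooth_def by (metis C_k.simps(2))

lemma smooth_has_derivative: "smooth g \<Longrightarrow> (g has_derivative frechet_derivative g (at z)) (at z)"
  using smooth_differentiable frechet_derivative_works by blast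

lemma smooth_frechet: "smooth g \<Longrightarrow> smooth (\<lambda>z. frechet_derivative g (at z) v)"
  unfolding smooth_def by (metis C_k.simps(2))

lemma smooth_continuous: "smooth g \<Longrightarrow> continuous_on UNIV g"
  unfolding smooth_def by (metis C_k.simps(1))

lemma smooth_iter_partial: "smooth g \<Longrightarrow> smooth (iter_partial w g)"
  by (induction w) (simp_all add: smooth_frechet)

text \<open>One shape covers both modifications applied to stabilizer elements: translations and the
  dilations \<open>h (t z) / t\<close>. It is preserved by differentiation, with \<open>c\<close>
  replaced by \<open>c * s\<close>.\<close>

lemma affine_rescale_has_derivative:
  assumes "smooth g"
  shows "((\<lambda>z. c *\<^sub>R g (s *\<^sub>R z + a) + b) has_derivative
    (\<lambda>v. (c * s) *\<^sub>R frechet_derivative g (at (s *\<^sub>R z + a)) v)) (at z)"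
proof -
  let ?D = "frechet_derivative g (at (s *\<^sub>R z + a))"
  have D: "(g has_derivative ?D) (at (s *\<^sub>R z + a))" by (rule smooth_has_derivative[OF assms])
  have "((\<lambda>z. s *\<^sub>R z + a) has_derivative (\<lambda>v. s *\<^sub>R v)) (at z)"
    by (auto intro!: derivative_eq_intros)
  from has_derivative_compose[OF this D]
  have "((\<lambda>z. c *\<^sub>R g (s *\<^sub>R z + a) + b) has_derivative (\<lambda>v. c *\<^sub>R ?D (s *\<^sub>R v))) (at z)"
    by (auto intro!: derivative_eq_intros)
  then show ?thesis
    by (simp add: linear_scale[OF has_derivative_linear[OF D]])
qed

lemma frechet_affine_rescale:
  assumes "smooth g"
  shows "frechet_derivative (\<lambda>z. c *\<^sub>R g (s *\<^sub>R z + a) + b) (at z) v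
    = (c * s) *\<^sub>R frechet_derivative g (at (s *\<^sub>R z + a)) v"
  using frechet_derivative_at[OF affine_rescale_has_derivative[OF assms]] by metis

lemma smooth_affine_rescale:
  assumes "smooth g"
  shows "smooth (\<lambda>z. c *\<^sub>R g (s *\<^sub>R z + a) + b)"
proof -
  have "C_k k (\<lambda>z. c *\<^sub>R g (s *\<^sub>R z + a) + b)" for k
    using assms
  proof (induction k arbitrary: g c b)
    case 0
    have "continuous_on UNIV (\<lambda>z. g (s *\<^sub>R z + a))"
      by (rule continuous_on_compose2[OF smooth_continuous[OF 0]]) (auto intro!: continuous_intros)
    then show ?case by (auto intro!: continuous_intros)
  next
    case (Suc k)
    have "(\<lambda>z. c *\<^sub>R g (s *\<^sub>R z + a) + b) differentiable (at z)" for z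
      using affine_rescale_has_derivative[OF Suc.prems] differentiableI by blast
    moreover have "C_k k (\<lambda>z. frechet_derivative (\<lambda>z. c *\<^sub>R g (s *\<^sub>R z + a) + b) (at z) v)" for v
      using Suc.IH[OF smooth_frechet[OF Suc.prems], of "c * s" v 0]
      by (simp add: frechet_affine_rescale[OF Suc.prems])
    ultimately show ?case by simp
  qed
  then show ?thesis by (simp add: smooth_def)
qed

lemma iter_partial_rescale:
  assumes "smooth g"
  shows "iter_partial w (\<lambda>z. c *\<^sub>R g (s *\<^sub>R z)) = (\<lambda>z. (c * s ^ length w) *\<^sub>R iter_partial w g (s *\<^sub>R z))"
proof (induction w)
  case (Cons i w)
  show ?case
    using frechet_affine_rescale[OF smooth_iter_partial[OF assms], where c = "c * s ^ length w" and s = s and a = 0 and b = 0]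
    by (simp add: Cons mult_ac)
qed simp

lemma iter_partial_add_const:
  assumes "smooth g"
  shows "iter_partial w (\<lambda>z. g z + b) = (\<lambda>z. iter_partial w g z + (if w = [] then b else 0))"
proof (induction w)
  case (Cons i w)
  show ?case
    using frechet_affine_rescale[OF smooth_iter_partial[OF assms], where c = 1 and s = 1 and a = 0]
    by (simp add: Cons)
qed simp

lemma iter_partial_linear:
  fixes A :: "real^2 \<Rightarrow> real^2"
  assumes "linear A"
  shows "iter_partial w A = (case w of [] \<Rightarrow> A | [i] \<Rightarrow> (\<lambda>_. A (axis i 1)) | _ \<Rightarrow> (\<lambda>_. 0))"
proof (induction w)
  case (Cons i w)
  have A: "frechet_derivative A (at z) = A" for z
    using frechet_derivative_at[OF linear_imp_has_derivative[OF assms]] by metis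
  show ?case
    unfolding iter_partial.simps Cons by (auto split: list.split simp: A)
qed simp

text \<open>The paths of \<open>stabilizer_id\<close> with a free starting point and a free set
  \<open>S\<close>, so that they can be reversed, concatenated and confined to maps that fix the
  origin.\<close>

definition isotopic :: "(real^2 \<Rightarrow> real^2) set \<Rightarrow> enat \<Rightarrow> (real^2 \<Rightarrow> real^2) \<Rightarrow> (real^2 \<Rightarrow> real^2) \<Rightarrow> bool" where
  "isotopic S r g h \<longleftrightarrow> (\<exists>H :: real \<Rightarrow> real^2 \<Rightarrow> real^2.
     H 0 = g \<and> H 1 = h \<and> (\<forall>t\<in>{0..1}. H t \<in> S) \<and>
     (\<forall>w. enat (length w) \<le> r \<longrightarrow>
        continuous_on (UNIV \<times> {0..1}) (\<lambda>(z, t). iter_partial w (H t) z)))"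

lemma stabilizer_id_eq: "stabilizer_id f r = {h \<in> stabilizer f. isotopic (stabilizer f) r id h}"
  by (simp add: stabilizer_id_def isotopic_def)

lemma isotopic_mono: "isotopic S r g h \<Longrightarrow> S \<subseteq> T \<Longrightarrow> r' \<le> r \<Longrightarrow> isotopic T r' g h"
  unfolding isotopic_def
  by (elim exE, rule_tac x = H in exI) (auto intro: order_trans)

lemma isotopic_sym:
  assumes "isotopic S r g h"
  shows "isotopic S r h g"
proof -
  obtain H where H: "H 0 = g" "H 1 = h" "\<forall>t\<in>{0..1::real}. H t \<in> S"
    "\<And>w. enat (length w) \<le> r \<Longrightarrow> continuous_on (UNIV \<times> {0..1}) (\<lambda>(z, t). iter_partial w (H t) z)"
    using assms unfolding isotopic_def by blast
  have "continuous_on (UNIV \<times> {0..1}) (\<lambda>(z, t). iter_partial w (H (1 - t)) z)" if "enat (length w) \<le> r" for w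
  proof -
    have "continuous_on (UNIV \<times> {0..1::real}) (\<lambda>x. case (\<lambda>(z, t). (z, 1 - t)) x of (z, t) \<Rightarrow> iter_partial w (H t) z)"
      by (rule continuous_on_compose2[OF H(4)[OF that]])
        (auto intro!: continuous_intros simp: case_prod_unfold)
    then show ?thesis by (simp add: case_prod_unfold)
  qed
  then show ?thesis using H(1-3) unfolding isotopic_def
    by (intro exI[of _ "\<lambda>t. H (1 - t)"]) auto
qed

lemma isotopic_trans:
  assumes "isotopic S r g h" "isotopic S r h k"
  shows "isotopic S r g k"
proof -
  obtain H where H: "H 0 = g" "H 1 = h" "\<forall>t\<in>{0..1::real}. H t \<in> S"
    "\<And>w. enat (length w) \<le> r \<Longrightarrow> continuous_on (UNIV \<times> {0..1}) (\<lambda>(z, t). iter_partial w (H t) z)"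
    using assms(1) unfolding isotopic_def by blast
  obtain K where K: "K 0 = h" "K 1 = k" "\<forall>t\<in>{0..1::real}. K t \<in> S"
    "\<And>w. enat (length w) \<le> r \<Longrightarrow> continuous_on (UNIV \<times> {0..1}) (\<lambda>(z, t). iter_partial w (K t) z)"
    using assms(2) unfolding isotopic_def by blast
  define J where "J t = (if t \<le> 1/2 then H (2 * t) else K (2 * t - 1))" for t
  have "continuous_on (UNIV \<times> {0..1}) (\<lambda>(z, t). iter_partial w (J t) z)" if "enat (length w) \<le> r" for w
  proof -
    have 1: "continuous_on (UNIV \<times> {0..1/2}) (\<lambda>x. case (\<lambda>(z, t). (z, 2 * t)) x of (z, t) \<Rightarrow> iter_partial w (H t) z)"
      by (rule continuous_on_compose2[OF H(4)[OF that]])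
        (auto intro!: continuous_intros simp: case_prod_unfold)
    have 2: "continuous_on (UNIV \<times> {1/2..1}) (\<lambda>x. case (\<lambda>(z, t). (z, 2 * t - 1)) x of (z, t) \<Rightarrow> iter_partial w (K t) z)"
      by (rule continuous_on_compose2[OF K(4)[OF that]])
        (auto intro!: continuous_intros simp: case_prod_unfold)
    have 3: "UNIV \<times> {0..1} = UNIV \<times> {0..1/2} \<union> UNIV \<times> {1/2..1::real}" by auto
    have "continuous_on (UNIV \<times> {0..1/2} \<union> UNIV \<times> {1/2..1})
       (\<lambda>x::(real^2) \<times> real. if snd x \<le> 1/2
          then case (\<lambda>(z, t). (z, 2 * t)) x of (z, t) \<Rightarrow> iter_partial w (H t) z
          else case (\<lambda>(z, t). (z, 2 * t - 1)) x of (z, t) \<Rightarrow> iter_partial w (K t) z)"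
    proof (rule continuous_on_cases[OF _ _ 1 2])
      show "\<forall>x. x \<in> UNIV \<times> {0..1/2} \<and> \<not> snd x \<le> 1/2 \<or> x \<in> UNIV \<times> {1/2..1} \<and> snd x \<le> 1/2 \<longrightarrow>
          (case (\<lambda>(z, t). (z, 2 * t)) x of (z, t) \<Rightarrow> iter_partial w (H t) z) =
          (case (\<lambda>(z, t). (z, 2 * t - 1)) x of (z, t) \<Rightarrow> iter_partial w (K t) z)"
      proof (intro allI impI)
        fix x :: "(real^2) \<times> real"
        assume "x \<in> UNIV \<times> {0..1/2} \<and> \<not> snd x \<le> 1/2 \<or> x \<in> UNIV \<times> {1/2..1} \<and> snd x \<le> 1/2"
        then have "snd x = 1/2" by (cases x) auto
        then have "2 * snd x = 1" "2 * snd x - 1 = 0" by simp_all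
        then show "(case (\<lambda>(z, t). (z, 2 * t)) x of (z, t) \<Rightarrow> iter_partial w (H t) z) =
          (case (\<lambda>(z, t). (z, 2 * t - 1)) x of (z, t) \<Rightarrow> iter_partial w (K t) z)"
          using H(2) K(1) by (simp add: case_prod_unfold)
      qed
    qed (auto intro: closed_Times)
    then show ?thesis unfolding 3
      by (rule continuous_on_eq) (auto simp: J_def)
  qed
  moreover have "J 0 = g" "J 1 = k" "\<forall>t\<in>{0..1::real}. J t \<in> S"
    using H K by (auto simp: J_def)
  ultimately show ?thesis unfolding isotopic_def by blast
qed

text \<open>A linear map is determined by its values on the two axis vectors, its first partial
  derivatives are these values, and the higher ones vanish. So continuity at each fixed vector gives
  continuity in every order.\<close>

lemma isotopic_linear:
  fixes A :: "real \<Rightarrow> real^2 \<Rightarrow> real^2"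
  assumes "\<And>t. t \<in> {0..1} \<Longrightarrow> linear (A t)" "\<And>t. t \<in> {0..1} \<Longrightarrow> A t \<in> S"
    "\<And>v. continuous_on {0..1} (\<lambda>t. A t v)"
  shows "isotopic S r (A 0) (A 1)"
proof -
  have *: "continuous_on (UNIV \<times> {0..1}) (\<lambda>x::(real^2) \<times> real. A (snd x) v)" for v
    by (rule continuous_on_compose2[OF assms(3)]) (auto intro!: continuous_intros)
  have "continuous_on (UNIV \<times> {0..1}) (\<lambda>x::(real^2) \<times> real. iter_partial w (A (snd x)) (fst x))" for w
  proof -
    consider "w = []" | i where "w = [i]" | i j w' where "w = i # j # w'" by (metis list.exhaust)
    then show ?thesis
    proof cases
      case 1
      have "continuous_on (UNIV \<times> {0..1}) (\<lambda>x::(real^2) \<times> real.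
          (fst x $ 1) *\<^sub>R A (snd x) (axis 1 1) + (fst x $ 2) *\<^sub>R A (snd x) (axis 2 1))"
        by (intro continuous_intros *)
      then show ?thesis
        by (rule continuous_on_eq) (auto simp: 1 linear_vec2[OF assms(1), symmetric])
    next
      case 2
      show ?thesis
        by (rule continuous_on_eq[OF *[of "axis i 1"]]) (auto simp: 2 iter_partial_linear[OF assms(1)] simp del: iter_partial.simps)
    next
      case 3
      show ?thesis
        by (rule continuous_on_eq[OF continuous_on_const[of _ 0]]) (auto simp: 3 iter_partial_linear[OF assms(1)] simp del: iter_partial.simps)
    qed
  qed
  then show ?thesis unfolding isotopic_def
    by (intro exI[of _ A]) (auto simp: case_prod_unfold assms(2))
qed

section \<open>Stabilizer elements and the image of the origin\<close>

lemma diffeosI: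
  assumes "smooth h" "smooth k" "\<And>z. h (k z) = z" "\<And>z. k (h z) = z"
  shows "h \<in> diffeos"
proof -
  have "bij h" using assms(3,4) by (metis bijI')
  moreover have "inv h = k" using assms(3,4) by (metis \<open>bij h\<close> bij_inv_eq_iff ext)
  ultimately show ?thesis using assms by (simp add: diffeos_def)
qed

lemma diffeosD:
  assumes "h \<in> diffeos"
  shows "smooth h" "smooth (inv h)" "h (inv h z) = z" "inv h (h z) = z"
  using assms by (auto simp: diffeos_def bij_is_surj surj_f_inv_f bij_is_inj)

lemma stabilizerI: "h \<in> diffeos \<Longrightarrow> (\<And>z. f (h z) = f z) \<Longrightarrow> h \<in> stabilizer f"
  by (auto simp: stabilizer_def)

lemma stabilizerD: "h \<in> stabilizer f \<Longrightarrow> h \<in> diffeos" "h \<in> stabilizer f \<Longrightarrow> f (h z) = f z"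
  by (auto simp: stabilizer_def fun_eq_iff)

definition stabilizer0 :: "(real^2 \<Rightarrow> real) \<Rightarrow> (real^2 \<Rightarrow> real^2) set" where
  "stabilizer0 f = {h \<in> stabilizer f. h 0 = 0}"

text \<open>A nonconstant polynomial is unbounded at infinity, which a finite limit
  excludes.\<close>

lemma poly_bounded_imp_const:
  fixes q :: "real poly"
  assumes "(poly q \<longlongrightarrow> L) at_top"
  shows "poly q s = poly q 0"
proof (cases "degree q > 0")
  case True
  have "filterlim (poly q) at_infinity at_top"
    using filterlim_poly_at_infinity[OF True] at_top_le_at_infinity filterlim_mono by blast
  with assms show ?thesis
    using not_tendsto_and_filterlim_at_infinity trivial_limit_at_top_linorder by blast
next
  case False
  then obtain c where "q = [:c:]" using degree_eq_zeroE by blast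
  then show ?thesis by simp
qed

lemma homogeneous_poly_scaleR: "homogeneous_poly p f \<Longrightarrow> f (s *\<^sub>R z) = s ^ p * f z"
proof -
  assume "homogeneous_poly p f"
  then obtain a where a: "f z = (\<Sum>i\<le>p. a i * (z $ 1) ^ i * (z $ 2) ^ (p - i))" for z
    unfolding homogeneous_poly_def by blast
  have "s ^ p = s ^ i * s ^ (p - i)" if "i \<le> p" for i
    using that by (simp flip: power_add)
  then show ?thesis
    by (auto simp: a sum_distrib_left power_mult_distrib intro!: sum.cong)
qed

lemma homogeneous_poly_continuous:
  assumes "homogeneous_poly p f"
  shows "continuous_on S f"
proof -
  obtain a where "f = (\<lambda>z. \<Sum>i\<le>p. a i * (z $ 1) ^ i * (z $ 2) ^ (p - i))"
    using assms unfolding homogeneous_poly_def by blast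
  then show ?thesis by (auto intro!: continuous_intros)
qed

lemma homogeneous_poly_line:
  assumes "homogeneous_poly p f"
  obtains q where "\<And>s. f (s *\<^sub>R w + v) = poly q s"
proof -
  obtain a where a: "f z = (\<Sum>i\<le>p. a i * (z $ 1) ^ i * (z $ 2) ^ (p - i))" for z
    using assms unfolding homogeneous_poly_def by blast
  have "f (s *\<^sub>R w + v) = poly (\<Sum>i\<le>p. smult (a i) ([:v $ 1, w $ 1:] ^ i * [:v $ 2, w $ 2:] ^ (p - i))) s" for s
    by (simp add: a poly_sum mult.assoc) (simp add: add.commute)
  then show ?thesis using that by blast
qed

lemma directional_derivative_limit:
  fixes k :: "'a::real_normed_vector \<Rightarrow> 'b::real_normed_vector"
  assumes "(k has_derivative D) (at w)"
  shows "((\<lambda>e. (k (w + e *\<^sub>R v) - k w) /\<^sub>R e) \<longlongrightarrow> D v) (at 0)"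
proof -
  have "((\<lambda>e. w + e *\<^sub>R v) has_derivative (\<lambda>e. e *\<^sub>R v)) (at 0)"
    by (auto intro!: derivative_eq_intros)
  moreover have "(k has_derivative D) (at (w + 0 *\<^sub>R v))" using assms by simp
  ultimately have "((\<lambda>e. k (w + e *\<^sub>R v)) has_derivative (\<lambda>e. D (e *\<^sub>R v))) (at 0)"
    by (rule has_derivative_compose)
  then have "((\<lambda>e. norm (k (w + e *\<^sub>R v) - k w - e *\<^sub>R D v) / norm e) \<longlongrightarrow> 0) (at 0)"
    by (simp add: has_derivative_at linear_scale[OF has_derivative_linear[OF assms]])
  moreover have "\<forall>\<^sub>F e in at 0. norm (k (w + e *\<^sub>R v) - k w - e *\<^sub>R D v) / norm e
      = norm ((k (w + e *\<^sub>R v) - k w) /\<^sub>R e - D v)"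
  proof (rule eventually_mono[OF eventually_neq_at_within[of 0]])
    fix e :: real
    assume "e \<noteq> 0"
    then have "(k (w + e *\<^sub>R v) - k w) /\<^sub>R e - D v = (k (w + e *\<^sub>R v) - k w - e *\<^sub>R D v) /\<^sub>R e"
      by (simp add: scaleR_diff_right)
    then show "norm (k (w + e *\<^sub>R v) - k w - e *\<^sub>R D v) / norm e
      = norm ((k (w + e *\<^sub>R v) - k w) /\<^sub>R e - D v)"
      by (simp only: norm_scaleR norm_inverse divide_inverse_commute real_norm_def abs_inverse)
  qed
  ultimately have "((\<lambda>e. norm ((k (w + e *\<^sub>R v) - k w) /\<^sub>R e - D v)) \<longlongrightarrow> 0) (at 0)"
    by (rule Lim_transform_eventually)
  then show ?thesis by (rule LIM_zero_cancel[OF tendsto_norm_zero_cancel])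
qed

text \<open>Put \<open>k = inv h\<close>, \<open>w = h 0\<close> and \<open>e = 1 / s\<close>.
  Homogeneity and invariance under \<open>k\<close> give
  \<open>f (s w + v) = f (k (w + e v) / e)\<close>. As \<open>k w = 0\<close>, the argument on the
  right is a difference quotient, so the polynomial in \<open>s\<close> on the left has a finite
  limit.\<close>

lemma stabilizer_translation:
  assumes f: "homogeneous_poly p f" and h: "h \<in> stabilizer f"
  shows "f (s *\<^sub>R h 0 + v) = f v"
proof -
  define k where "k = inv h"
  define w where "w = h 0"
  note hd = diffeosD[OF stabilizerD(1)[OF h], folded k_def]
  have kw: "k w = 0" by (simp add: w_def hd)
  have fk: "f (k z) = f z" for z using stabilizerD(2)[OF h, of "k z"] by (simp add: hd)
  let ?D = "frechet_derivative k (at w)"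
  have "((\<lambda>e. (k (w + e *\<^sub>R v) - k w) /\<^sub>R e) \<longlongrightarrow> ?D v) (at 0)"
    by (rule directional_derivative_limit[OF smooth_has_derivative[OF hd(2)]])
  then have "((\<lambda>e. f (k (w + e *\<^sub>R v) /\<^sub>R e)) \<longlongrightarrow> f (?D v)) (at 0)"
    using continuous_on_tendsto_compose[OF homogeneous_poly_continuous[OF f, of UNIV]] by (simp add: kw)
  then have lim: "((\<lambda>e. f (k (w + e *\<^sub>R v) /\<^sub>R e)) \<longlongrightarrow> f (?D v)) (at_right 0)"
    by (rule filterlim_mono) (simp_all add: at_le)
  have "((\<lambda>s. f (k (w + inverse s *\<^sub>R v) /\<^sub>R inverse s)) \<longlongrightarrow> f (?D v)) at_top"
    by (rule filterlim_compose[OF lim filterlim_inverse_at_right_top])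
  moreover have "\<forall>\<^sub>F s in at_top. f (k (w + inverse s *\<^sub>R v) /\<^sub>R inverse s) = f (s *\<^sub>R w + v)"
    using eventually_gt_at_top[of 0]
  proof eventually_elim
    case (elim s)
    have "s *\<^sub>R w + v = s *\<^sub>R (w + inverse s *\<^sub>R v)" using elim by (simp add: scaleR_add_right)
    then show ?case by (simp add: homogeneous_poly_scaleR[OF f] fk)
  qed
  ultimately have lim2: "((\<lambda>s. f (s *\<^sub>R w + v)) \<longlongrightarrow> f (?D v)) at_top"
    by (rule Lim_transform_eventually)
  obtain q where q: "\<And>s. f (s *\<^sub>R w + v) = poly q s" using homogeneous_poly_line[OF f] by blast
  have "f (s *\<^sub>R w + v) = f (0 *\<^sub>R w + v)"
    unfolding q by (rule poly_bounded_imp_const) (rule lim2[unfolded q])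
  then show ?thesis by (simp add: w_def)
qed

section \<open>Linear parts\<close>

lemma stabilizer0_subset: "stabilizer0 f \<subseteq> stabilizer f"
  by (auto simp: stabilizer0_def)

lemma stabilizer0D: "h \<in> stabilizer0 f \<Longrightarrow> h \<in> stabilizer f" "h \<in> stabilizer0 f \<Longrightarrow> h 0 = 0"
  by (auto simp: stabilizer0_def)

lemma translate_in_stabilizer:
  assumes f: "homogeneous_poly p f" and h: "h \<in> stabilizer f"
  shows "(\<lambda>z. h z + s *\<^sub>R h 0) \<in> stabilizer f"
proof (rule stabilizerI)
  note hd = diffeosD[OF stabilizerD(1)[OF h]]
  show "f (h z + s *\<^sub>R h 0) = f z" for z
    using stabilizer_translation[OF f h, of s "h z"] stabilizerD(2)[OF h] by (simp add: add.commute)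
  show "(\<lambda>z. h z + s *\<^sub>R h 0) \<in> diffeos"
  proof (rule diffeosI)
    show "smooth (\<lambda>z. h z + s *\<^sub>R h 0)"
      using smooth_affine_rescale[OF hd(1), of 1 1 0] by simp
    show "smooth (\<lambda>z. inv h (z + - (s *\<^sub>R h 0)))"
      using smooth_affine_rescale[OF hd(2), of 1 1 "- (s *\<^sub>R h 0)" 0] by simp
  qed (simp_all add: hd)
qed

lemma sub_origin_in_stabilizer0:
  assumes "homogeneous_poly p f" "h \<in> stabilizer f"
  shows "(\<lambda>z. h z - h 0) \<in> stabilizer0 f"
  using translate_in_stabilizer[OF assms, of "-1"] by (simp add: stabilizer0_def)

lemma isotopic_sub_origin:
  assumes f: "homogeneous_poly p f" and h: "h \<in> stabilizer f"
  shows "isotopic (stabilizer f) r (\<lambda>z. h z - h 0) h"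
proof -
  define H where "H t = (\<lambda>z. h z + (t - 1) *\<^sub>R h 0)" for t :: real
  have sm: "smooth h" using diffeosD[OF stabilizerD(1)[OF h]] by blast
  have "continuous_on (UNIV \<times> {0..1}) (\<lambda>x. iter_partial w (H (snd x)) (fst x))" for w
    unfolding H_def iter_partial_add_const[OF sm]
    by (cases "w = []") (auto intro!: continuous_intros
      continuous_on_compose2[OF smooth_continuous[OF smooth_iter_partial[OF sm]]]
      continuous_on_compose2[OF smooth_continuous[OF sm]])
  moreover have "H t \<in> stabilizer f" for t
    unfolding H_def by (rule translate_in_stabilizer[OF f h])
  ultimately show ?thesis unfolding isotopic_def
    by (intro exI[of _ H]) (auto simp: case_prod_unfold H_def)
qed

lemma rescale_in_stabilizer0:
  assumes f: "homogeneous_poly p f" and h: "h \<in> stabilizer0 f" and t: "t \<noteq> 0"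
  shows "(\<lambda>z. (1 / t) *\<^sub>R h (t *\<^sub>R z)) \<in> stabilizer0 f"
proof -
  note hd = diffeosD[OF stabilizerD(1)[OF stabilizer0D(1)[OF h]]]
  have "(\<lambda>z. (1 / t) *\<^sub>R h (t *\<^sub>R z)) \<in> diffeos"
  proof (rule diffeosI)
    show "smooth (\<lambda>z. (1 / t) *\<^sub>R h (t *\<^sub>R z))"
      using smooth_affine_rescale[OF hd(1), of "1 / t" t 0 0] by simp
    show "smooth (\<lambda>z. (1 / t) *\<^sub>R inv h (t *\<^sub>R z))"
      using smooth_affine_rescale[OF hd(2), of "1 / t" t 0 0] by simp
  qed (simp_all add: hd t)
  moreover have "f ((1 / t) *\<^sub>R h (t *\<^sub>R z)) = f z" for z
    using t by (simp add: homogeneous_poly_scaleR[OF f] stabilizerD(2)[OF stabilizer0D(1)[OF h]] power_one_over)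
  ultimately show ?thesis
    by (simp add: stabilizer0_def stabilizerI stabilizer0D(2)[OF h])
qed

text \<open>The chain rule makes the derivatives of \<open>h\<close> and \<open>inv h\<close> at the
  fixed point 0 inverse to each other. Invariance holds because \<open>f (h (e v) / e) = f v\<close>
  for every \<open>e > 0\<close>, and the argument on the left tends to the derivative applied to
  \<open>v\<close>.\<close>

lemma derivative_in_stabilizer0_aux:
  assumes f: "homogeneous_poly p f" and h: "h \<in> stabilizer0 f"
  shows "linear (frechet_derivative h (at 0))" "frechet_derivative h (at 0) \<in> stabilizer0 f"
proof -
  note hd = diffeosD[OF stabilizerD(1)[OF stabilizer0D(1)[OF h]]]
  define k where "k = inv h"
  note hd = hd[folded k_def]
  have 0: "h 0 = 0" by (rule stabilizer0D[OF h])
  have k0: "k 0 = 0" using hd(4)[of 0] 0 by simp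
  let ?A = "frechet_derivative h (at 0)" and ?B = "frechet_derivative k (at 0)"
  have A: "(h has_derivative ?A) (at 0)" and B: "(k has_derivative ?B) (at 0)"
    using hd smooth_has_derivative by blast+
  show lin: "linear ?A" using has_derivative_linear[OF A] .
  have linB: "linear ?B" using has_derivative_linear[OF B] .
  have "((\<lambda>z. k (h z)) has_derivative (\<lambda>z. ?B (?A z))) (at 0)"
    by (rule has_derivative_compose[OF A]) (simp add: 0 B)
  then have BA: "?B (?A z) = z" for z
    using has_derivative_unique[OF _ has_derivative_ident, of "\<lambda>z. ?B (?A z)" 0] by (simp add: hd) metis
  have "((\<lambda>z. h (k z)) has_derivative (\<lambda>z. ?A (?B z))) (at 0)"
    by (rule has_derivative_compose[OF B]) (simp add: k0 A)
  then have AB: "?A (?B z) = z" for z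
    using has_derivative_unique[OF _ has_derivative_ident, of "\<lambda>z. ?A (?B z)" 0] by (simp add: hd) metis
  have "f (?A v) = f v" for v
  proof (rule tendsto_unique)
    have "((\<lambda>e. h (e *\<^sub>R v) /\<^sub>R e) \<longlongrightarrow> ?A v) (at 0)"
      using directional_derivative_limit[OF A, of v] 0 by simp
    then have "((\<lambda>e. f (h (e *\<^sub>R v) /\<^sub>R e)) \<longlongrightarrow> f (?A v)) (at 0)"
      using continuous_on_tendsto_compose[OF homogeneous_poly_continuous[OF f, of UNIV]] by simp
    then show "((\<lambda>e. f (h (e *\<^sub>R v) /\<^sub>R e)) \<longlongrightarrow> f (?A v)) (at_right 0)"
      by (rule filterlim_mono) (simp_all add: at_le)
    have "\<forall>\<^sub>F e in at_right 0. f v = f (h (e *\<^sub>R v) /\<^sub>R e)"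
      using eventually_at_right_less[of 0]
    proof eventually_elim
      case (elim e)
      then show ?case
        by (simp add: homogeneous_poly_scaleR[OF f] stabilizerD(2)[OF stabilizer0D(1)[OF h]] power_inverse)
    qed
    then show "((\<lambda>e. f (h (e *\<^sub>R v) /\<^sub>R e)) \<longlongrightarrow> f v) (at_right 0)"
      by (rule Lim_transform_eventually[OF tendsto_const])
  qed simp
  moreover have "?A \<in> diffeos"
    by (rule diffeosI[OF smooth_linear[OF lin] smooth_linear[OF linB] AB BA])
  ultimately show "?A \<in> stabilizer0 f"
    by (simp add: stabilizer0_def stabilizerI linear_0[OF lin])
qed

lemma frechet_sub_origin:
  "smooth h \<Longrightarrow> frechet_derivative (\<lambda>z. h z - h 0) (at z) = frechet_derivative h (at z)"
  using frechet_affine_rescale[of h 1 1 0 "- h 0" z] by (simp add: fun_eq_iff)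

lemma derivative_in_stabilizer0:
  assumes f: "homogeneous_poly p f" and h: "h \<in> stabilizer f"
  shows "linear (frechet_derivative h (at 0))" "frechet_derivative h (at 0) \<in> stabilizer0 f"
  using derivative_in_stabilizer0_aux[OF f sub_origin_in_stabilizer0[OF f h]]
    diffeosD(1)[OF stabilizerD(1)[OF h]] by (simp_all add: frechet_sub_origin)

text \<open>Alexander trick: by homogeneity \<open>h (t z) / t\<close> preserves \<open>f\<close> too, and it tends to the linear part
  of \<open>h\<close> for \<open>t \<rightarrow> 0\<close> together with all derivatives, those of order \<open>n\<close> being scaled by \<open>t\<^sup>n\<^sup>-\<^sup>1\<close>.\<close>

lemma isotopic_linear_part:
  assumes f: "homogeneous_poly p f" and h: "h \<in> stabilizer0 f"
  shows "isotopic (stabilizer0 f) r (frechet_derivative h (at 0)) h"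
proof -
  let ?A = "frechet_derivative h (at 0)"
  define H where "H t = (if t = 0 then ?A else (\<lambda>z. (1 / t) *\<^sub>R h (t *\<^sub>R z)))" for t :: real
  have sm: "smooth h" and 0: "h 0 = 0"
    using diffeosD[OF stabilizerD(1)[OF stabilizer0D(1)[OF h]]] stabilizer0D[OF h] by blast+
  note lin = derivative_in_stabilizer0_aux[OF f h]
  have "continuous_on (UNIV \<times> {0..1}) (\<lambda>x. iter_partial w (H (snd x)) (fst x))" for w
  proof (cases w)
    case Nil
    \<comment> \<open>The normalized remainder of the first-order expansion. It is continuous even
      at 0, where division by zero gives the right value 0, so that
      \<open>H t z = ?A z + norm z *\<^sub>R R (t *\<^sub>R z)\<close> is visibly continuous at
      \<open>t = 0\<close>.\<close>
    define R where "R u = (h u - ?A u) /\<^sub>R norm u" for u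
    have contA: "continuous_on UNIV ?A" using linear_continuous_on linear_linear lin(1) by blast
    have "continuous (at u) R" for u
    proof (cases "u = 0")
      case True
      have "(h has_derivative ?A) (at 0)" by (rule smooth_has_derivative[OF sm])
      then have "((\<lambda>u. norm (R u)) \<longlongrightarrow> 0) (at 0)"
        by (simp add: has_derivative_at 0 R_def divide_inverse mult.commute)
      then show ?thesis using True
        by (simp add: isCont_def R_def tendsto_norm_zero_cancel)
    next
      case False
      have "isCont h u" "isCont ?A u" using smooth_continuous[OF sm] contA
        by (auto simp: continuous_on_eq_continuous_at)
      with False show ?thesis unfolding R_def by (intro continuous_intros) auto
    qed
    then have R: "continuous_on UNIV R" by (simp add: continuous_at_imp_continuous_on)
    have "H t z = ?A z + norm z *\<^sub>R R (t *\<^sub>R z)" if "t \<in> {0..1}" for t z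
    proof (cases "t = 0 \<or> z = 0")
      case True
      then show ?thesis by (auto simp: H_def R_def 0 linear_0[OF lin(1)])
    next
      case False
      then show ?thesis using that
        by (simp add: H_def R_def linear_scale[OF lin(1)] scaleR_diff_right field_simps)
    qed
    moreover have "continuous_on (UNIV \<times> {0..1}) (\<lambda>x. ?A (fst x) + norm (fst x) *\<^sub>R R (snd x *\<^sub>R fst x))"
      by (intro continuous_intros continuous_on_compose2[OF R] continuous_on_compose2[OF contA]) auto
    ultimately show ?thesis
      by (subst continuous_on_cong[OF refl]) (auto simp: Nil)
  next
    case (Cons i w')
    \<comment> \<open>At \<open>t = 0\<close> this relies on \<open>0 ^ 0 = 1\<close>: the first
      derivatives of \<open>H 0\<close> are those of \<open>h\<close> at the origin, and all higher
      ones vanish.\<close>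
    have "iter_partial w (H t) z = t ^ length w' *\<^sub>R iter_partial w h (t *\<^sub>R z)" for t z
    proof (cases "t = 0")
      case True
      then show ?thesis
        by (cases w') (simp_all add: H_def iter_partial_linear[OF lin(1)] Cons del: iter_partial.simps(2),
          simp)
    next
      case False
      then show ?thesis
        by (simp add: H_def iter_partial_rescale[OF sm] Cons del: iter_partial.simps)
    qed
    moreover have "continuous_on (UNIV \<times> {0..1})
        (\<lambda>x. snd x ^ length w' *\<^sub>R iter_partial w h (snd x *\<^sub>R fst x))"
      by (intro continuous_intros continuous_on_compose2[OF smooth_continuous[OF smooth_iter_partial[OF sm]]]) auto
    ultimately show ?thesis by simp
  qed
  moreover have "H t \<in> stabilizer0 f" for t
    using rescale_in_stabilizer0[OF f h] lin(2) by (simp add: H_def)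
  ultimately show ?thesis unfolding isotopic_def
    by (intro exI[of _ H]) (auto simp: case_prod_unfold H_def)
qed

lemma isotopic_derivative:
  assumes f: "homogeneous_poly p f" and h: "h \<in> stabilizer f"
  shows "isotopic (stabilizer f) r (frechet_derivative h (at 0)) h"
proof -
  have "isotopic (stabilizer f) r (frechet_derivative h (at 0)) (\<lambda>z. h z - h 0)"
    using isotopic_mono[OF isotopic_linear_part[OF f sub_origin_in_stabilizer0[OF f h]] stabilizer0_subset order_refl, of r]
    by (simp add: frechet_sub_origin diffeosD(1)[OF stabilizerD(1)[OF h]])
  then show ?thesis using isotopic_sub_origin[OF f h] isotopic_trans by blast
qed

text \<open>Here order 1 enters: the partial derivatives along \<open>w = [i]\<close>, restricted to
  the origin, are the columns of the linear parts. The stages need not fix the origin, but their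
  derivatives there still preserve \<open>f\<close>.\<close>

lemma C1_isotopic_linear_path:
  assumes f: "homogeneous_poly p f" and h: "isotopic (stabilizer f) 1 id h"
  obtains A :: "real \<Rightarrow> real^2 \<Rightarrow> real^2"
  where "\<And>t. t \<in> {0..1} \<Longrightarrow> linear (A t)" "\<And>t. t \<in> {0..1} \<Longrightarrow> A t \<in> stabilizer0 f"
    "\<And>v. continuous_on {0..1} (\<lambda>t. A t v)" "A 0 = id" "A 1 = frechet_derivative h (at 0)"
proof -
  obtain H :: "real \<Rightarrow> real^2 \<Rightarrow> real^2" where H: "H 0 = id" "H 1 = h" "\<And>t. t \<in> {0..1} \<Longrightarrow> H t \<in> stabilizer f"
    "\<And>w. enat (length w) \<le> 1 \<Longrightarrow> continuous_on (UNIV \<times> {0..1}) (\<lambda>(z, t). iter_partial w (H t) z)"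
    using h unfolding isotopic_def by blast
  define A where "A t = frechet_derivative (H t) (at 0)" for t
  have lin: "linear (A t)" if "t \<in> {0..1}" for t
    unfolding A_def by (rule derivative_in_stabilizer0[OF f H(3)[OF that]])
  have e: "continuous_on {0..1} (\<lambda>t. A t (axis i 1))" for i
    using continuous_on_compose2[OF H(4)[of "[i]"], of "{0..1}" "\<lambda>t. (0, t)"]
    by (simp add: A_def one_enat_def continuous_intros image_subset_iff)
  have "continuous_on {0..1} (\<lambda>t. A t v)" for v
  proof (rule continuous_on_eq)
    show "continuous_on {0..1} (\<lambda>t. (v $ 1) *\<^sub>R A t (axis 1 1) + (v $ 2) *\<^sub>R A t (axis 2 1))"
      by (intro continuous_intros e)
  qed (simp add: linear_vec2[OF lin, symmetric])
  moreover have "A 0 = id"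
    using frechet_derivative_at[OF has_derivative_ident, of "0::real^2"] by (simp add: A_def H id_def)
  moreover have "A t \<in> stabilizer0 f" if "t \<in> {0..1}" for t
    unfolding A_def by (rule derivative_in_stabilizer0[OF f H(3)[OF that]])
  ultimately show ?thesis using that[of A] lin by (simp add: A_def H)
qed

text \<open>The path is replaced by two legs that are continuous in every order: a path of linear
  maps from \<open>id\<close> to the linear part of \<open>h\<close>, and the dilations and
  translations from there to \<open>h\<close>.\<close>

lemma C1_isotopic_imp_isotopic:
  assumes f: "homogeneous_poly p f" and h: "h \<in> stabilizer f" "isotopic (stabilizer f) 1 id h"
  shows "isotopic (stabilizer f) r id h"
proof -
  obtain A :: "real \<Rightarrow> real^2 \<Rightarrow> real^2"
    where A: "\<And>t. t \<in> {0..1} \<Longrightarrow> linear (A t)" "\<And>t. t \<in> {0..1} \<Longrightarrow> A t \<in> stabilizer0 f"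
    "\<And>v. continuous_on {0..1} (\<lambda>t. A t v)" "A 0 = id" "A 1 = frechet_derivative h (at 0)"
    using C1_isotopic_linear_path[OF f h(2)] by blast
  have "isotopic (stabilizer f) r (A 0) (A 1)"
    using A(1-3) stabilizer0_subset by (intro isotopic_linear) blast+
  then show ?thesis unfolding A(4,5)
    using isotopic_derivative[OF f h(1)] isotopic_trans by blast
qed

lemma stabilizer_id_eq_infinity:
  assumes "homogeneous_poly p f" "1 \<le> r"
  shows "stabilizer_id f r = stabilizer_id f \<infinity>"
  unfolding stabilizer_id_eq
  using C1_isotopic_imp_isotopic[OF assms(1)] isotopic_mono[OF _ order_refl]
  by (meson assms(2) enat_ord_code(3))

lemma C0_isotopic_imp_linear_part:
  assumes f: "homogeneous_poly p f" and h: "h \<in> stabilizer f" "isotopic (stabilizer f) 0 id h"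
  shows "isotopic (stabilizer0 f) 0 id (frechet_derivative h (at 0))"
proof -
  obtain H :: "real \<Rightarrow> real^2 \<Rightarrow> real^2" where H: "H 0 = id" "H 1 = h" "\<And>t. t \<in> {0..1} \<Longrightarrow> H t \<in> stabilizer f"
    "\<And>w. enat (length w) \<le> 0 \<Longrightarrow> continuous_on (UNIV \<times> {0..1}) (\<lambda>(z, t). iter_partial w (H t) z)"
    using h unfolding isotopic_def by blast
  define K where "K t = (\<lambda>z. H t z - H t 0)" for t
  have c: "continuous_on (UNIV \<times> {0..1}) (\<lambda>x. H (snd x) (fst x))"
    using H(4)[of "[]"] by (simp add: case_prod_unfold zero_enat_def)
  have "continuous_on (UNIV \<times> {0..1}) (\<lambda>x::(real^2) \<times> real. H (snd x) 0)"
    using continuous_on_compose2[OF c, of "UNIV \<times> {0..1}" "\<lambda>x. (0, snd x)"]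
    by (simp add: continuous_intros image_subset_iff)
  then have "continuous_on (UNIV \<times> {0..1}) (\<lambda>x. K (snd x) (fst x))"
    unfolding K_def by (intro continuous_intros c)
  moreover have "K t \<in> stabilizer0 f" if "t \<in> {0..1}" for t
    unfolding K_def by (rule sub_origin_in_stabilizer0[OF f H(3)[OF that]])
  ultimately have "isotopic (stabilizer0 f) 0 id (\<lambda>z. h z - h 0)"
    unfolding isotopic_def by (intro exI[of _ K]) (auto simp: case_prod_unfold K_def H zero_enat_def[symmetric] enat_0_iff)
  moreover have "isotopic (stabilizer0 f) 0 (frechet_derivative h (at 0)) (\<lambda>z. h z - h 0)"
    using isotopic_linear_part[OF f sub_origin_in_stabilizer0[OF f h(1)]]
    by (simp add: frechet_sub_origin diffeosD(1)[OF stabilizerD(1)[OF h(1)]])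
  ultimately show ?thesis using isotopic_sym isotopic_trans by blast
qed

section \<open>Invariants of continuous isotopies\<close>

definition det2 :: "(real^2 \<Rightarrow> real^2) \<Rightarrow> real" where
  "det2 A = A (axis 1 1) $ 1 * A (axis 2 1) $ 2 - A (axis 1 1) $ 2 * A (axis 2 1) $ 1"

lemma vec2_eq_iff: "z = w \<longleftrightarrow> z $ 1 = w $ 1 \<and> z $ 2 = w $ 2" for z w :: "'a^2"
  by (simp add: vec_eq_iff forall_2)

text \<open>The loop is the image of the unit circle under the real-linear map with \<open>z\<close>
  going to \<open>a * z + b * cnj z\<close>. The first term is scaled to 0 while the loop avoids the
  origin; then \<open>b\<close> is deformed to 1 through \<open>exp ((1 - t) * Ln b)\<close>, which
  never vanishes. What remains is the reversed circle.\<close>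

lemma winding_number_cis_conj:
  assumes "b \<noteq> 0"
    "\<And>t s. 0 \<le> t \<Longrightarrow> t \<le> 1 \<Longrightarrow> of_real (1 - t) * a * cis (2 * pi * s) + b * cis (- (2 * pi * s)) \<noteq> 0"
  shows "winding_number (\<lambda>s. a * cis (2 * pi * s) + b * cis (- (2 * pi * s))) 0 = - 1"
proof -
  let ?p = "\<lambda>s. a * cis (2 * pi * s) + b * cis (- (2 * pi * s))"
  have r: "reversepath (circlepath 0 1) = (\<lambda>s. cis (- (2 * pi * s)))"
  proof (rule ext)
    fix s :: real
    have "cis (2 * pi - 2 * pi * s) = cis (- (2 * pi * s))"
      by (simp add: cis.ctr cos_diff sin_diff)
    then show "reversepath (circlepath 0 1) s = cis (- (2 * pi * s))"
      by (simp add: reversepath_def circlepath cis_conv_exp right_diff_distrib mult_ac)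
  qed
  have c1: "cis (- (2 * pi)) = 1" by (simp add: cis.ctr complex_eq_iff)
  have "homotopic_loops (- {0}) ?p (\<lambda>s. b * cis (- (2 * pi * s)))"
    unfolding homotopic_loops
  proof (intro exI conjI)
    show "continuous_on ({0..1} \<times> {0..1})
       (\<lambda>x. of_real (1 - fst x) * a * cis (2 * pi * snd x) + b * cis (- (2 * pi * snd x)))"
      by (intro continuous_intros)
    show "(\<lambda>x. of_real (1 - fst x) * a * cis (2 * pi * snd x) + b * cis (- (2 * pi * snd x)))
        \<in> {0..1} \<times> {0..1} \<rightarrow> - {0}"
      using assms(2) by (auto simp del: of_real_diff)
  qed (auto simp: pathfinish_def pathstart_def c1)
  moreover have "homotopic_loops (- {0}) (\<lambda>s. b * cis (- (2 * pi * s))) (\<lambda>s. cis (- (2 * pi * s)))"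
    unfolding homotopic_loops
  proof (intro exI conjI)
    show "continuous_on ({0..1} \<times> {0..1})
       (\<lambda>x. exp (of_real (1 - fst x) * Ln b) * cis (- (2 * pi * snd x)))"
      by (intro continuous_intros)
  qed (use assms(1) in \<open>auto simp: pathfinish_def pathstart_def c1\<close>)
  ultimately have "winding_number ?p 0 = winding_number (reversepath (circlepath 0 1)) 0"
    unfolding r by (rule winding_number_homotopic_loops[OF homotopic_loops_trans])
  also have "\<dots> = - 1"
    by (subst winding_number_reversepath) (simp_all add: winding_number_circlepath_centre)
  finally show ?thesis .
qed

lemma stabilizer0_nonzero: "h \<in> stabilizer0 f \<Longrightarrow> z \<noteq> 0 \<Longrightarrow> h z \<noteq> 0"
  using diffeosD(4)[OF stabilizerD(1)[OF stabilizer0D(1)]] stabilizer0D(2) by metis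

text \<open>Bijections fixing the origin map the unit circle to loops around it, so the winding
  number stays 1 along the path. A determinant that is not positive would make the conjugate-linear
  part of \<open>A\<close> dominate and give winding number -1.\<close>

lemma isotopic_det_pos:
  assumes A: "linear A" and iso: "isotopic (stabilizer0 f) 0 id A"
  shows "det2 A > 0"
proof (rule ccontr)
  assume neg: "\<not> det2 A > 0"
  obtain H :: "real \<Rightarrow> real^2 \<Rightarrow> real^2" where H: "H 0 = id" "H 1 = A" "\<And>t. t \<in> {0..1} \<Longrightarrow> H t \<in> stabilizer0 f"
    "\<And>w. enat (length w) \<le> 0 \<Longrightarrow> continuous_on (UNIV \<times> {0..1}) (\<lambda>(z, t). iter_partial w (H t) z)"
    using iso unfolding isotopic_def by blast
  have c: "continuous_on (UNIV \<times> {0..1}) (\<lambda>x. H (snd x) (fst x))"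
    using H(4)[of "[]"] by (simp add: case_prod_unfold zero_enat_def)
  define u :: "real \<Rightarrow> real^2" where "u s = vector [cos (2 * pi * s), sin (2 * pi * s)]" for s
  have u: "u s $ 1 = cos (2 * pi * s)" "u s $ 2 = sin (2 * pi * s)" for s by (simp_all add: u_def)
  have u0: "u s \<noteq> 0" for s
    using sin_cos_squared_add[of "2 * pi * s"] by (auto simp: vec2_eq_iff u simp del: sin_cos_squared_add)
  have contu: "continuous_on S u" for S
  proof -
    have "continuous_on S (\<lambda>s. cos (2 * pi * s) *\<^sub>R axis 1 1 + sin (2 * pi * s) *\<^sub>R axis 2 1 :: real^2)"
      by (intro continuous_intros)
    moreover have "u = (\<lambda>s. cos (2 * pi * s) *\<^sub>R axis 1 1 + sin (2 * pi * s) *\<^sub>R axis 2 1)"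
      by (rule ext) (simp add: vec2_eq_iff u axis_def)
    ultimately show ?thesis by simp
  qed
  define d where "d z = of_real (z $ 1) + \<i> * of_real (z $ 2)" for z :: "real^2"
  have d0: "d z = 0 \<longleftrightarrow> z = 0" for z by (simp add: d_def vec2_eq_iff complex_eq_iff)
  \<comment> \<open>In the complex coordinate \<open>d\<close>, the map \<open>A\<close> sends
    \<open>z\<close> to \<open>al * z + be * cnj z\<close>, and \<open>det2 A\<close> is the
    difference of the squared moduli of \<open>al\<close> and \<open>be\<close>.\<close>
  define al where "al = Complex ((A (axis 1 1) $ 1 + A (axis 2 1) $ 2) / 2) ((A (axis 1 1) $ 2 - A (axis 2 1) $ 1) / 2)"
  define be where "be = Complex ((A (axis 1 1) $ 1 - A (axis 2 1) $ 2) / 2) ((A (axis 1 1) $ 2 + A (axis 2 1) $ 1) / 2)"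
  have dA: "d (A (u s)) = al * cis (2 * pi * s) + be * cis (- (2 * pi * s))" for s
    unfolding d_def linear_vec2[OF A, of "u s"] u al_def be_def
    by (simp add: complex_eq_iff algebra_simps add_divide_distrib diff_divide_distrib)
  have "(cmod al)\<^sup>2 - (cmod be)\<^sup>2 = det2 A"
    unfolding cmod_power2 al_def be_def det2_def by (simp add: power2_eq_square field_simps)
  then have le: "cmod al \<le> cmod be" using neg by (simp add: power2_le_imp_le)
  have A0: "d (A z) \<noteq> 0" if "z \<noteq> 0" for z
    using stabilizer0_nonzero[OF H(3)[of 1] that] by (simp add: H d0)
  have be0: "be \<noteq> 0"
    using le A0[OF u0[of 0]] unfolding dA by auto
  \<comment> \<open>The moduli of \<open>al\<close> and \<open>be\<close> are only known to be
    weakly ordered. For \<open>t > 0\<close> the factor \<open>1 - t\<close> makes the comparison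
    strict; at \<open>t = 0\<close> injectivity of \<open>A\<close> is used instead.\<close>
  have nz: "of_real (1 - t) * al * cis (2 * pi * s) + be * cis (- (2 * pi * s)) \<noteq> 0" if "0 \<le> t" "t \<le> 1" for t s
  proof (cases "t = 0")
    case True
    then show ?thesis using A0[OF u0[of s]] by (simp add: dA)
  next
    case False
    have "cmod (of_real (1 - t) * al * cis (2 * pi * s)) = (1 - t) * cmod al"
      using that by (simp add: norm_mult del: of_real_diff)
    also have "\<dots> \<le> (1 - t) * cmod be" using le that by (simp add: mult_left_mono)
    also have "\<dots> < cmod be" using be0 that False by (simp add: mult_less_cancel_right2)
    also have "\<dots> = cmod (be * cis (- (2 * pi * s)))" by (simp add: norm_mult)
    finally have lt: "cmod (of_real (1 - t) * al * cis (2 * pi * s)) < cmod (be * cis (- (2 * pi * s)))" .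
    show ?thesis
    proof
      assume "of_real (1 - t) * al * cis (2 * pi * s) + be * cis (- (2 * pi * s)) = 0"
      then have "be * cis (- (2 * pi * s)) = - (of_real (1 - t) * al * cis (2 * pi * s))"
        by (simp only: eq_neg_iff_add_eq_0 add.commute)
      with lt show False by (simp only: norm_minus_cancel less_irrefl)
    qed
  qed
  have circ: "circlepath 0 1 = (\<lambda>s. cis (2 * pi * s))"
    by (simp add: circlepath cis_conv_exp fun_eq_iff mult_ac)
  have "homotopic_loops (- {0}) (\<lambda>s. cis (2 * pi * s)) (\<lambda>s. al * cis (2 * pi * s) + be * cis (- (2 * pi * s)))"
    unfolding homotopic_loops
  proof (intro exI conjI)
    have "continuous_on ({0..1} \<times> {0..1}) (\<lambda>x. H (fst x) (u (snd x)))"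
      using continuous_on_compose2[OF c, of "{0..1} \<times> {0..1}" "\<lambda>x. (u (snd x), fst x)"]
      by (simp add: image_subset_iff continuous_intros continuous_on_compose2[OF contu[of UNIV]])
    then show "continuous_on ({0..1} \<times> {0..1}) (\<lambda>x. d (H (fst x) (u (snd x))))"
      unfolding d_def by (intro continuous_intros)
    show "(\<lambda>x. d (H (fst x) (u (snd x)))) \<in> {0..1} \<times> {0..1} \<rightarrow> - {0}"
      using stabilizer0_nonzero[OF H(3) u0] by (auto simp: d0)
    have "u 1 = u 0" by (simp add: vec2_eq_iff u)
    then show "\<forall>t\<in>{0..1}. pathfinish ((\<lambda>x. d (H (fst x) (u (snd x)))) \<circ> Pair t) =
        pathstart ((\<lambda>x. d (H (fst x) (u (snd x)))) \<circ> Pair t)"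
      by (simp add: pathfinish_def pathstart_def)
  qed (simp_all add: H dA, simp add: d_def u complex_eq_iff)
  from winding_number_homotopic_loops[OF this] have "winding_number (circlepath 0 1) 0 = - 1"
    unfolding circ using winding_number_cis_conj[where a = al and b = be, OF be0 nz] by (rule trans)
  then show False by (simp add: winding_number_circlepath_centre)
qed

text \<open>Off the first axis, a zero is determined up to scaling by its slope coordinate
  \<open>x = u $ 1 / u $ 2\<close>, a root of a nonzero polynomial in one variable. The two unit
  vectors on the axis are added in any case.\<close>

lemma finite_unit_zeros:
  assumes "homogeneous_poly p f"
  shows "finite {u. norm u = 1 \<and> f u = 0}"
proof -
  obtain a where a: "f z = (\<Sum>i\<le>p. a i * (z $ 1) ^ i * (z $ 2) ^ (p - i))" and a0: "\<exists>i\<le>p. a i \<noteq> 0" for z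
    using assms unfolding homogeneous_poly_def by blast
  define Z where "Z = {x. (\<Sum>i\<le>p. a i * x ^ i) = 0}"
  define e :: "real \<Rightarrow> real^2" where "e x = vector [x, 1]" for x
  have "finite Z" unfolding Z_def using polyfun_finite_roots[of a p] a0 by simp
  moreover have "{u. norm u = 1 \<and> f u = 0} \<subseteq>
    (\<lambda>(s, x). s *\<^sub>R sgn (e x)) ` ({1, -1} \<times> Z) \<union> {axis 1 1, - axis 1 1}"
  proof
    fix u :: "real^2"
    assume "u \<in> {u. norm u = 1 \<and> f u = 0}"
    then have n: "norm u = 1" and fu: "f u = 0" by auto
    have n2: "(u $ 1)\<^sup>2 + (u $ 2)\<^sup>2 = 1"
      using n by (simp add: norm_vec_def L2_set_def UNIV_2)
    show "u \<in> (\<lambda>(s, x). s *\<^sub>R sgn (e x)) ` ({1, -1} \<times> Z) \<union> {axis 1 1, - axis 1 1}"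
    proof (cases "u $ 2 = 0")
      case True
      then have "u $ 1 = 1 \<or> u $ 1 = -1" using n2 by (simp add: power2_eq_1_iff)
      then show ?thesis using True by (auto simp: vec2_eq_iff axis_def)
    next
      case False
      define x where "x = u $ 1 / u $ 2"
      have ue: "u = u $ 2 *\<^sub>R e x" using False by (simp add: vec2_eq_iff e_def x_def)
      have "0 = (u $ 2) ^ p * f (e x)"
        using fu homogeneous_poly_scaleR[OF assms, of "u $ 2" "e x"] ue by simp
      then have "f (e x) = 0" using False by simp
      then have "x \<in> Z" by (simp add: a e_def Z_def)
      moreover have "u = sgn (u $ 2) *\<^sub>R sgn (e x)"
      proof -
        have "u = sgn u" using n by (simp add: sgn_div_norm)
        also have "\<dots> = sgn (u $ 2) *\<^sub>R sgn (e x)" by (subst ue) (simp add: sgn_scaleR)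
        finally show ?thesis .
      qed
      moreover have "sgn (u $ 2) \<in> {1, -1}" using False by (simp add: sgn_real_def)
      ultimately show ?thesis by force
    qed
  qed
  ultimately show ?thesis by (meson finite.emptyI finite.insertI finite_SigmaI finite_UnI finite_imageI finite_subset)
qed

text \<open>The normalized track of \<open>v\<close> moves continuously inside the finite set of
  unit zeros, hence is constant.\<close>

lemma isotopic_preserves_zero_rays:
  assumes f: "homogeneous_poly p f" and iso: "isotopic (stabilizer0 f) 0 id h" and v: "f v = 0" "v \<noteq> 0"
  obtains c where "c > 0" "h v = c *\<^sub>R v"
proof -
  obtain H :: "real \<Rightarrow> real^2 \<Rightarrow> real^2" where H: "H 0 = id" "H 1 = h" "\<And>t. t \<in> {0..1} \<Longrightarrow> H t \<in> stabilizer0 f"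
    "\<And>w. enat (length w) \<le> 0 \<Longrightarrow> continuous_on (UNIV \<times> {0..1}) (\<lambda>(z, t). iter_partial w (H t) z)"
    using iso unfolding isotopic_def by blast
  have c: "continuous_on (UNIV \<times> {0..1}) (\<lambda>x. H (snd x) (fst x))"
    using H(4)[of "[]"] by (simp add: case_prod_unfold zero_enat_def)
  have nz: "H t v \<noteq> 0" if "t \<in> {0..1}" for t
    using stabilizer0_nonzero[OF H(3)[OF that] v(2)] .
  define u where "u t = H t v /\<^sub>R norm (H t v)" for t
  have "continuous_on {0..1} (\<lambda>t. H t v)"
    using continuous_on_compose2[OF c, of "{0..1}" "\<lambda>t. (v, t)"]
    by (simp add: image_subset_iff continuous_intros)
  then have "continuous_on {0..1} u"
    unfolding u_def using nz by (intro continuous_intros) auto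
  then have "connected (u ` {0..1})" by (simp add: connected_continuous_image)
  moreover have "u ` {0..1} \<subseteq> {u. norm u = 1 \<and> f u = 0}"
    using nz by (auto simp: u_def homogeneous_poly_scaleR[OF f] stabilizerD(2)[OF stabilizer0D(1)[OF H(3)]] v(1))
  then have "finite (u ` {0..1})" using finite_unit_zeros[OF f] finite_subset by blast
  ultimately obtain x where x: "u ` {0..1} = {x}"
    using connected_finite_iff_sing[of "u ` {0..1}"] by auto
  have "u 0 \<in> u ` {0..1}" "u 1 \<in> u ` {0..1}" by (intro imageI, simp)+
  then have u01: "u 0 = u 1" unfolding x by simp
  have "h v \<noteq> 0" using nz[of 1] by (simp add: H)
  then have "h v = norm (h v) *\<^sub>R u 1" by (simp add: u_def H)
  also have "\<dots> = (norm (h v) / norm v) *\<^sub>R v"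
    unfolding u01[symmetric] by (simp add: u_def H divide_inverse)
  finally have "h v = (norm (h v) / norm v) *\<^sub>R v" .
  moreover have "norm (h v) / norm v > 0" using \<open>h v \<noteq> 0\<close> v(2) by simp
  ultimately show ?thesis using that by blast
qed

section \<open>Paths of linear maps\<close>

lemma linear_in_stabilizer0:
  assumes "linear A" "linear B" "\<And>z. A (B z) = z" "\<And>z. B (A z) = z" "\<And>z. f (A z) = f z"
  shows "A \<in> stabilizer0 f"
  using assms by (simp add: stabilizer0_def stabilizerI diffeosI[of A B] smooth_linear linear_0)

text \<open>Unlike \<open>homogeneous_poly\<close> this admits the zero form, so that the class is
  closed under sums.\<close>

definition binary_form :: "nat \<Rightarrow> (real \<Rightarrow> real \<Rightarrow> real) \<Rightarrow> bool" where
  "binary_form n F \<longleftrightarrow> (\<exists>c. \<forall>x y. F x y = (\<Sum>i\<le>n. c i * x ^ i * y ^ (n - i)))"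

lemma binary_form_add:
  assumes "binary_form n F" "binary_form n G"
  shows "binary_form n (\<lambda>x y. F x y + G x y)"
proof -
  obtain c d where "\<And>x y. F x y = (\<Sum>i\<le>n. c i * x ^ i * y ^ (n - i))"
    "\<And>x y. G x y = (\<Sum>i\<le>n. d i * x ^ i * y ^ (n - i))"
    using assms unfolding binary_form_def by blast
  then show ?thesis unfolding binary_form_def
    by (intro exI[of _ "\<lambda>i. c i + d i"]) (simp add: sum.distrib distrib_right)
qed

lemma binary_form_cmult:
  assumes "binary_form n F"
  shows "binary_form n (\<lambda>x y. a * F x y)"
proof -
  obtain c where "\<And>x y. F x y = (\<Sum>i\<le>n. c i * x ^ i * y ^ (n - i))"
    using assms unfolding binary_form_def by blast
  then show ?thesis unfolding binary_form_def
    by (intro exI[of _ "\<lambda>i. a * c i"]) (simp add: sum_distrib_left mult.assoc)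
qed

lemma binary_form_sum: "finite I \<Longrightarrow> (\<And>i. i \<in> I \<Longrightarrow> binary_form n (F i)) \<Longrightarrow> binary_form n (\<lambda>x y. \<Sum>i\<in>I. F i x y)"
proof (induction I rule: finite_induct)
  case empty
  show ?case unfolding binary_form_def by (intro exI[of _ "\<lambda>_. 0"]) simp
next
  case (insert i I)
  then show ?case by (simp add: binary_form_add)
qed

lemma binary_form_mult_linear:
  assumes "binary_form n F"
  shows "binary_form (Suc n) (\<lambda>x y. (a * x + b * y) * F x y)"
proof -
  obtain c where c: "\<And>x y. F x y = (\<Sum>i\<le>n. c i * x ^ i * y ^ (n - i))"
    using assms unfolding binary_form_def by blast
  have "binary_form (Suc n) (\<lambda>x y. x * F x y)"
    unfolding binary_form_def
    by (intro exI[of _ "\<lambda>i. if i = 0 then 0 else c (i - 1)"])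
      (simp add: c sum.atMost_Suc_shift sum_distrib_left mult_ac del: sum.atMost_Suc)
  moreover have "binary_form (Suc n) (\<lambda>x y. y * F x y)"
    unfolding binary_form_def
  proof (intro exI[of _ "\<lambda>i. if i = Suc n then 0 else c i"] allI)
    fix x y :: real
    have "(\<Sum>i\<le>n. (if i = Suc n then 0 else c i) * x ^ i * y ^ (Suc n - i)) = (\<Sum>i\<le>n. y * (c i * x ^ i * y ^ (n - i)))"
      by (intro sum.cong) (auto simp: Suc_diff_le)
    then show "y * F x y = (\<Sum>i\<le>Suc n. (if i = Suc n then 0 else c i) * x ^ i * y ^ (Suc n - i))"
      by (simp add: c sum_distrib_left)
  qed
  ultimately have "binary_form (Suc n) (\<lambda>x y. a * (x * F x y) + b * (y * F x y))"
    by (intro binary_form_add binary_form_cmult)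
  then show ?thesis by (simp add: distrib_right mult.assoc)
qed

lemma binary_form_linear_powers:
  "binary_form (i + j) (\<lambda>x y. (a * x + b * y) ^ i * (c * x + d * y) ^ j)"
proof (induction i)
  case 0
  show ?case
  proof (induction j)
    case 0
    show ?case unfolding binary_form_def by (intro exI[of _ "\<lambda>_. 1"]) simp
  next
    case (Suc j)
    then show ?case using binary_form_mult_linear[OF Suc, of c d] by (simp add: mult_ac)
  qed
next
  case (Suc i)
  then show ?case using binary_form_mult_linear[OF Suc, of a b] by (simp add: mult.assoc)
qed

text \<open>Monomials in linear forms are again binary forms. If all new coefficients vanished, so
  would \<open>f\<close> at every point, because \<open>v\<close> and \<open>w\<close> span the
  plane.\<close>

lemma homogeneous_poly_basis:
  assumes f: "homogeneous_poly p f" and basis: "\<And>z. z = X z *\<^sub>R v + Y z *\<^sub>R w"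
  obtains c where "\<exists>i\<le>p. c i \<noteq> 0"
    "\<And>x y. f (x *\<^sub>R v + y *\<^sub>R w) = (\<Sum>i\<le>p. c i * x ^ i * y ^ (p - i))"
proof -
  obtain a where a: "f z = (\<Sum>i\<le>p. a i * (z $ 1) ^ i * (z $ 2) ^ (p - i))" and a0: "\<exists>i\<le>p. a i \<noteq> 0" for z
    using f unfolding homogeneous_poly_def by blast
  have "binary_form p (\<lambda>x y. a i * ((v $ 1 * x + w $ 1 * y) ^ i * (v $ 2 * x + w $ 2 * y) ^ (p - i)))" if "i \<le> p" for i
    using binary_form_cmult[OF binary_form_linear_powers[of i "p - i"]] that by simp
  then have "binary_form p (\<lambda>x y. \<Sum>i\<le>p. a i * ((v $ 1 * x + w $ 1 * y) ^ i * (v $ 2 * x + w $ 2 * y) ^ (p - i)))"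
    by (intro binary_form_sum) auto
  then obtain c where c: "\<And>x y. f (x *\<^sub>R v + y *\<^sub>R w) = (\<Sum>i\<le>p. c i * x ^ i * y ^ (p - i))"
    unfolding binary_form_def by (auto simp: a mult_ac)
  have "\<exists>i\<le>p. c i \<noteq> 0"
  proof (rule ccontr)
    assume "\<not> (\<exists>i\<le>p. c i \<noteq> 0)"
    then have "f (X z *\<^sub>R v + Y z *\<^sub>R w) = 0" for z unfolding c by simp
    then have "f z = 0" for z by (subst basis[of z])
    then have "(\<Sum>i\<le>p. a i * x ^ i) = 0" for x using a[of "vector [x, 1]"] by simp
    then show False using polyfun_eq_0[of a p] a0 by blast
  qed
  then show ?thesis using that c by blast
qed

text \<open>\<open>X\<close> and \<open>Y\<close> are the coordinate functions of the basis
  \<open>v\<close>, \<open>w\<close>. They are parameters because an orthogonal basis and an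
  eigenbasis are both needed.\<close>

locale plane_basis =
  fixes X Y :: "real^2 \<Rightarrow> real" and v w :: "real^2"
  assumes linX: "linear X" and linY: "linear Y"
    and expand: "\<And>z. z = X z *\<^sub>R v + Y z *\<^sub>R w"
    and X_comb: "\<And>x y. X (x *\<^sub>R v + y *\<^sub>R w) = x"
    and Y_comb: "\<And>x y. Y (x *\<^sub>R v + y *\<^sub>R w) = y"
begin

lemma linear_comb: "linear (\<lambda>z. (a * X z + b * Y z) *\<^sub>R v + (c * X z + d * Y z) *\<^sub>R w)"
  by (intro linearI) (simp_all add: linear_add[OF linX] linear_add[OF linY] linear_scale[OF linX] linear_scale[OF linY] algebra_simps)

text \<open>Comparing coefficients at \<open>y = 1\<close> gives
  \<open>l ^ i * m ^ (p - i) = 1\<close> for each monomial that occurs in \<open>f\<close>. This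
  survives raising \<open>l\<close> and \<open>m\<close> to the real power \<open>t\<close>.\<close>

lemma isotopic_diagonal:
  assumes f: "homogeneous_poly p f" and A: "A \<in> stabilizer0 f" and l: "l > 0" and m: "m > 0"
    and A_eq: "\<And>z. A z = (l * X z) *\<^sub>R v + (m * Y z) *\<^sub>R w"
  shows "isotopic (stabilizer0 f) r id A"
proof -
  obtain c where c: "f (x *\<^sub>R v + y *\<^sub>R w) = (\<Sum>i\<le>p. c i * x ^ i * y ^ (p - i))" for x y
    using homogeneous_poly_basis[OF f expand] by blast
  define B where "B t = (\<lambda>z. (l powr t * X z) *\<^sub>R v + (m powr t * Y z) *\<^sub>R w)" for t :: real
  have "(\<Sum>i\<le>p. (c i * l ^ i * m ^ (p - i)) * x ^ i) = (\<Sum>i\<le>p. c i * x ^ i)" for x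
  proof -
    have "(\<Sum>i\<le>p. (c i * l ^ i * m ^ (p - i)) * x ^ i) = f ((l * x) *\<^sub>R v + (m * 1) *\<^sub>R w)"
      unfolding c by (simp add: power_mult_distrib mult_ac)
    also have "\<dots> = f (A (x *\<^sub>R v + 1 *\<^sub>R w))" unfolding A_eq X_comb Y_comb ..
    also have "\<dots> = f (x *\<^sub>R v + 1 *\<^sub>R w)"
      by (rule stabilizerD(2)[OF stabilizer0D(1)[OF A]])
    also have "\<dots> = (\<Sum>i\<le>p. c i * x ^ i)" unfolding c by simp
    finally show ?thesis .
  qed
  then have "\<forall>i\<le>p. c i * l ^ i * m ^ (p - i) = c i"
    using polyfun_eq_coeffs[of "\<lambda>i. c i * l ^ i * m ^ (p - i)" p c] by blast
  then have c1: "c i = 0 \<or> l ^ i * m ^ (p - i) = 1" if "i \<le> p" for i using that by (auto simp: mult.assoc)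
  have c2: "c i * ((l powr t) ^ i * (m powr t) ^ (p - i)) = c i" if "i \<le> p" for i t
  proof (cases "c i = 0")
    case False
    have "(l powr t) ^ i * (m powr t) ^ (p - i) = (l ^ i * m ^ (p - i)) powr t"
      using l m by (simp add: powr_mult powr_power powr_realpow[symmetric] powr_powr mult.commute)
    also have "\<dots> = 1" using c1[OF that] False by simp
    finally show ?thesis by simp
  qed simp
  have fB: "f (B t z) = f z" for t z
  proof -
    have "f (B t z) = (\<Sum>i\<le>p. c i * ((l powr t) ^ i * (m powr t) ^ (p - i)) * X z ^ i * Y z ^ (p - i))"
      unfolding B_def c by (simp add: power_mult_distrib mult_ac)
    also have "\<dots> = (\<Sum>i\<le>p. c i * X z ^ i * Y z ^ (p - i))"
      by (intro sum.cong) (simp_all add: c2)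
    also have "\<dots> = f z" unfolding c[symmetric] expand[of z, symmetric] ..
    finally show ?thesis .
  qed
  have lin: "linear (B t)" for t
    unfolding B_def using linear_comb[of "l powr t" 0 0 "m powr t"] by simp
  have inv: "B t (B (- t) z) = z" for t z
    unfolding B_def X_comb Y_comb using l m
    by (simp add: mult.assoc[symmetric] expand[symmetric] flip: powr_add)
  have "B t \<in> stabilizer0 f" for t
    using linear_in_stabilizer0[OF lin[of t] lin[of "- t"]] inv[of t] inv[of "- t"] fB by simp
  moreover have "continuous_on {0..1} (\<lambda>t. B t z)" for z
    unfolding B_def using l m by (intro continuous_intros) auto
  ultimately have "isotopic (stabilizer0 f) r (B 0) (B 1)"
    using lin by (intro isotopic_linear)
  moreover have "B 0 = id" "B 1 = A"
    using l m by (auto simp: B_def A_eq fun_eq_iff expand[symmetric])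
  ultimately show ?thesis by simp
qed

text \<open>Let \<open>q\<close> be \<open>f\<close> dehomogenized in the given basis. Comparing
  leading coefficients gives \<open>l ^ p = 1\<close>, hence \<open>l = 1\<close>, and
  \<open>q\<close> is invariant under the shift by \<open>n = k / l\<close>. If \<open>n\<close> is
  nonzero, then \<open>q\<close> takes one value infinitely often and is constant, so
  \<open>f\<close> depends on the second coordinate alone and every shear preserves it.\<close>

lemma isotopic_shear:
  assumes f: "homogeneous_poly p f" and p: "p \<ge> 1" and A: "A \<in> stabilizer0 f" and l: "l > 0"
    and A_eq: "\<And>z. A z = (l * X z + k * Y z) *\<^sub>R v + (l * Y z) *\<^sub>R w"
  shows "isotopic (stabilizer0 f) r id A"
proof -
  obtain c where c0: "\<exists>i\<le>p. c i \<noteq> 0" and c: "f (x *\<^sub>R v + y *\<^sub>R w) = (\<Sum>i\<le>p. c i * x ^ i * y ^ (p - i))" for x y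
    using homogeneous_poly_basis[OF f expand] by blast
  define q where "q = (\<Sum>i\<le>p. monom (c i) i)"
  have q: "poly q x = f (x *\<^sub>R v + 1 *\<^sub>R w)" for x
    by (simp only: c) (simp add: q_def poly_sum poly_monom)
  have "q \<noteq> 0"
  proof
    assume "q = 0"
    then have "(\<Sum>i\<le>p. c i * x ^ i) = 0" for x using q[of x] by (simp only: c) simp
    then show False using polyfun_eq_0[of c p] c0 by blast
  qed
  define n where "n = k / l"
  have shift: "l ^ p * poly q (x + n) = poly q x" for x
  proof -
    have "l ^ p * poly q (x + n) = f (l *\<^sub>R ((x + n) *\<^sub>R v + 1 *\<^sub>R w))"
      unfolding q homogeneous_poly_scaleR[OF f] ..
    also have "l *\<^sub>R ((x + n) *\<^sub>R v + 1 *\<^sub>R w) = A (x *\<^sub>R v + 1 *\<^sub>R w)"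
      unfolding A_eq X_comb Y_comb using l by (simp add: n_def scaleR_add_right distrib_left)
    also have "f (A (x *\<^sub>R v + 1 *\<^sub>R w)) = poly q x"
      unfolding q by (rule stabilizerD(2)[OF stabilizer0D(1)[OF A]])
    finally show ?thesis .
  qed
  have "smult (l ^ p) (pcompose q [:n, 1:]) = q"
    by (rule poly_ext) (use shift in \<open>simp add: poly_pcompose add.commute\<close>)
  then have "lead_coeff (smult (l ^ p) (pcompose q [:n, 1:])) = lead_coeff q" by (rule arg_cong)
  then have "l ^ p * lead_coeff q = lead_coeff q"
    using l lead_coeff_comp[of "[:n, 1:]" q] by (simp add: lead_coeff_smult)
  then have "l ^ p = 1" using \<open>q \<noteq> 0\<close> by simp
  then have l1: "l = 1" using l p power_eq_1_iff[OF \<open>l ^ p = 1\<close>] by simp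
  have c_zero: "c i * n = 0" if "0 < i" "i \<le> p" for i
  proof (cases "n = 0")
    case False
    have "poly q (real j * n) = poly q 0" for j
    proof (induction j)
      case (Suc j)
      then show ?case using shift[of "real j * n"] l1 by (simp add: distrib_right add.commute)
    qed simp
    then have "(\<lambda>j. real j * n) ` UNIV \<subseteq> {x. poly (q - [:poly q 0:]) x = 0}" by auto
    moreover have "infinite ((\<lambda>j. real j * n) ` UNIV)"
      using False by (intro range_inj_infinite) (simp add: inj_on_def)
    ultimately have "infinite {x. poly (q - [:poly q 0:]) x = 0}" using finite_subset by blast
    then have "q - [:poly q 0:] = 0" using poly_roots_finite[of "q - [:poly q 0:]"] by argo
    then have "coeff (q - [:poly q 0:]) i = 0" by (simp only: coeff_0)
    then have "coeff q i = 0" using that by (cases i) simp_all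
    then show ?thesis using that by (simp add: q_def coeff_sum)
  qed simp
  have c_eq: "f (x *\<^sub>R v + y *\<^sub>R w) = f (x' *\<^sub>R v + y *\<^sub>R w)" if "n \<noteq> 0" for x x' y
    unfolding c
  proof (rule sum.cong[OF refl])
    fix i assume "i \<in> {..p}"
    then show "c i * x ^ i * y ^ (p - i) = c i * x' ^ i * y ^ (p - i)"
      using c_zero[of i] that by (cases "i = 0") auto
  qed
  define B where "B t = (\<lambda>z. (X z + (t * n) * Y z) *\<^sub>R v + Y z *\<^sub>R w)" for t
  have fB: "f (B t z) = f z" for t z
  proof (cases "n = 0")
    case True
    then show ?thesis by (simp add: B_def expand[symmetric])
  next
    case False
    then have "f (B t z) = f (X z *\<^sub>R v + Y z *\<^sub>R w)" unfolding B_def by (rule c_eq)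
    then show ?thesis by (simp add: expand[symmetric])
  qed
  have lin: "linear (B t)" for t
    unfolding B_def using linear_comb[of 1 "t * n" 0 1] by simp
  have inv: "B t (B (- t) z) = z" for t z
    unfolding B_def X_comb Y_comb by (simp add: expand[symmetric])
  have "B t \<in> stabilizer0 f" for t
    using linear_in_stabilizer0[OF lin[of t] lin[of "- t"]] inv[of t] inv[of "- t"] fB by simp
  moreover have "continuous_on {0..1} (\<lambda>t. B t z)" for z
    unfolding B_def by (intro continuous_intros)
  ultimately have "isotopic (stabilizer0 f) r (B 0) (B 1)"
    using lin by (intro isotopic_linear)
  moreover have "B 0 = id" "B 1 = A"
    by (auto simp: B_def A_eq fun_eq_iff n_def l1 expand[symmetric])
  ultimately show ?thesis by simp
qed

end

text \<open>An invariant matrix with positive eigenvalues lies on a one-parameter group of invariant matrices: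
  in an eigenbasis invariance says that certain monomials in the eigenvalues are \<open>1\<close>.\<close>

lemma isotopic_positive_eigenvalue:
  assumes f: "homogeneous_poly p f" and p: "p \<ge> 1" and A: "A \<in> stabilizer0 f" "linear A"
    and det: "det2 A > 0" and v: "v \<noteq> 0" "A v = l *\<^sub>R v" "l > 0"
  shows "isotopic (stabilizer0 f) r id A"
proof -
  define n where "n = (v $ 1)\<^sup>2 + (v $ 2)\<^sup>2"
  have n: "n > 0" using v(1) by (auto simp: n_def vec2_eq_iff sum_power2_gt_zero_iff)
  \<comment> \<open>A quarter turn of \<open>v\<close>, so that the coordinates are inner products
    divided by the squared length \<open>n\<close>.\<close>
  define w :: "real^2" where "w = vector [- v $ 2, v $ 1]"
  have w: "w $ 1 = - v $ 2" "w $ 2 = v $ 1" by (simp_all add: w_def)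
  define X where "X z = (z $ 1 * v $ 1 + z $ 2 * v $ 2) / n" for z :: "real^2"
  define Y where "Y z = (z $ 2 * v $ 1 - z $ 1 * v $ 2) / n" for z :: "real^2"
  have nv: "v $ 1 * v $ 1 + v $ 2 * v $ 2 = n" by (simp add: n_def power2_eq_square)
  have ex: "z = X z *\<^sub>R v + Y z *\<^sub>R w" for z
  proof -
    have "X z * v $ 1 + Y z * w $ 1 = (z $ 1 * (v $ 1 * v $ 1 + v $ 2 * v $ 2)) / n"
      "X z * v $ 2 + Y z * w $ 2 = (z $ 2 * (v $ 1 * v $ 1 + v $ 2 * v $ 2)) / n"
      by (simp_all add: X_def Y_def w add_divide_distrib diff_divide_distrib algebra_simps)
    then show ?thesis using n by (simp add: vec2_eq_iff nv)
  qed
  have Xc: "X (x *\<^sub>R v + y *\<^sub>R w) = x" for x y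
  proof -
    have "X (x *\<^sub>R v + y *\<^sub>R w) = (x * (v $ 1 * v $ 1 + v $ 2 * v $ 2)) / n"
      by (simp add: X_def w algebra_simps)
    then show ?thesis using n by (simp add: nv)
  qed
  have Yc: "Y (x *\<^sub>R v + y *\<^sub>R w) = y" for x y
  proof -
    have "Y (x *\<^sub>R v + y *\<^sub>R w) = (y * (v $ 1 * v $ 1 + v $ 2 * v $ 2)) / n"
      by (simp add: Y_def w algebra_simps)
    then show ?thesis using n by (simp add: nv)
  qed
  have linX: "linear X" and linY: "linear Y"
    by (intro linearI; simp add: X_def Y_def algebra_simps add_divide_distrib diff_divide_distrib)+
  define k where "k = X (A w)"
  define m where "m = Y (A w)"
  have Aw: "A w = k *\<^sub>R v + m *\<^sub>R w" unfolding k_def m_def by (rule ex)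
  have A_eq: "A z = (l * X z + k * Y z) *\<^sub>R v + (m * Y z) *\<^sub>R w" for z
  proof -
    have "A z = X z *\<^sub>R A v + Y z *\<^sub>R A w"
      by (subst ex[of z]) (simp only: linear_add[OF A(2)] linear_scale[OF A(2)])
    then show ?thesis by (simp add: v(2) Aw algebra_simps)
  qed
  \<comment> \<open>\<open>m\<close> is the second eigenvalue, and \<open>l * m = det2 A\<close>.
    The identity is proved after multiplication by \<open>n\<close>, which avoids fractions.\<close>
  have m: "m > 0"
  proof -
    define a b c d where "a = A (axis 1 1) $ 1" and "b = A (axis 2 1) $ 1"
      and "c = A (axis 1 1) $ 2" and "d = A (axis 2 1) $ 2"
    have Az: "A z $ 1 = z $ 1 * a + z $ 2 * b" "A z $ 2 = z $ 1 * c + z $ 2 * d" for z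
      by (subst linear_vec2[OF A(2), of z], simp add: a_def b_def c_def d_def)+
    have l1: "l * v $ 1 = v $ 1 * a + v $ 2 * b" and l2: "l * v $ 2 = v $ 1 * c + v $ 2 * d"
      using v(2) Az[of v] by (simp_all add: vec2_eq_iff)
    have mn: "m * n = (v $ 1 * d - v $ 2 * c) * v $ 1 - (v $ 1 * b - v $ 2 * a) * v $ 2"
      using n by (simp add: m_def Y_def Az w)
    have "l * (m * n) = (l * v $ 1) * (v $ 1 * d - v $ 2 * c) - (l * v $ 2) * (v $ 1 * b - v $ 2 * a)"
      unfolding mn by (simp add: algebra_simps)
    also have "\<dots> = det2 A * n"
      unfolding l1 l2 det2_def a_def[symmetric] b_def[symmetric] c_def[symmetric] d_def[symmetric] n_def
      by (simp add: algebra_simps power2_eq_square)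
    finally have "l * (m * n) = det2 A * n" .
    then have "l * (m * n) > 0" using mult_pos_pos[OF det n] by (simp only:)
    then show ?thesis using v(3) n by (simp add: zero_less_mult_iff)
  qed
  show ?thesis
  proof (cases "m = l")
    case True
    interpret plane_basis X Y v w
      by (rule plane_basis.intro[OF linX linY ex Xc Yc])
    show ?thesis using isotopic_shear[OF f p A(1) v(3), of k r] A_eq True by simp
  next
    case False
    \<comment> \<open>Solves \<open>A (w + e *\<^sub>R v) = m *\<^sub>R (w + e *\<^sub>R v)\<close>,
      that is \<open>e * (m - l) = k\<close>; the two distinct eigenvalues then give an
      eigenbasis.\<close>
    define e where "e = k / (m - l)"
    have e: "e * (m - l) = k" using False by (simp add: e_def)
    interpret plane_basis "\<lambda>z. X z - e * Y z" Y v "w + e *\<^sub>R v"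
    proof (rule plane_basis.intro)
      show "linear (\<lambda>z. X z - e * Y z)"
        by (intro linearI) (simp_all add: linear_add[OF linX] linear_add[OF linY] linear_scale[OF linX] linear_scale[OF linY] algebra_simps)
      have comb: "x *\<^sub>R v + y *\<^sub>R (w + e *\<^sub>R v) = (x + e * y) *\<^sub>R v + y *\<^sub>R w" for x y
        by (simp add: algebra_simps)
      show "z = (X z - e * Y z) *\<^sub>R v + Y z *\<^sub>R (w + e *\<^sub>R v)" for z
        unfolding comb using ex[of z] by simp
      show "X (x *\<^sub>R v + y *\<^sub>R (w + e *\<^sub>R v)) - e * Y (x *\<^sub>R v + y *\<^sub>R (w + e *\<^sub>R v)) = x" for x y
        unfolding comb Xc Yc by simp
      show "Y (x *\<^sub>R v + y *\<^sub>R (w + e *\<^sub>R v)) = y" for x y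
        unfolding comb Yc ..
    qed (rule linY)
    have "A z = (l * (X z - e * Y z)) *\<^sub>R v + (m * Y z) *\<^sub>R (w + e *\<^sub>R v)" for z
    proof -
      have "l * X z + k * Y z = l * (X z - e * Y z) + m * Y z * e"
        unfolding e[symmetric] by (simp add: algebra_simps)
      then show ?thesis unfolding A_eq by (simp add: scaleR_add_right scaleR_add_left)
    qed
    then show ?thesis by (rule isotopic_diagonal[OF f A(1) v(3) m])
  qed
qed

section \<open>Definite forms\<close>

text \<open>As \<open>Q\<close> is nonnegative and \<open>b \<ge> 1\<close>, invariance passes from
  the power to \<open>Q\<close> itself. Completing the square turns \<open>Q\<close> into the
  squared modulus and \<open>A\<close> into an orthogonal map, which is a rotation because its
  determinant is positive. Scaling the rotation angle gives the path.\<close>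

lemma isotopic_definite_square:
  assumes f: "\<And>z. f z = c * Q z ^ b" and c: "c \<noteq> 0" and b: "b \<ge> 1" and Q: "pos_def_form Q"
    and A: "A \<in> stabilizer0 f" "linear A" and det: "det2 A > 0"
  shows "isotopic (stabilizer0 f) r id A"
proof -
  obtain q where q: "Q z = (\<Sum>i\<le>2. q i * (z $ 1) ^ i * (z $ 2) ^ (2 - i))" for z
    using Q unfolding pos_def_form_def homogeneous_poly_def by blast
  have Qz: "Q z = q 0 * (z $ 2)\<^sup>2 + q 1 * z $ 1 * z $ 2 + q 2 * (z $ 1)\<^sup>2" for z
    by (simp add: q numeral_2_eq_2)
  have Qpos: "Q z > 0" if "z \<noteq> 0" for z using Q that by (simp add: pos_def_form_def)
  have Qnn: "Q z \<ge> 0" for z using Qpos[of z] by (cases "z = 0") (auto simp: Qz)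
  have q2: "q 2 > 0" using Qpos[of "axis 1 1"] by (simp add: Qz axis_def vec2_eq_iff)
  have disc: "q 0 - (q 1)\<^sup>2 / (4 * q 2) > 0"
  proof -
    \<comment> \<open>This vector annihilates the square that contains \<open>z $ 1\<close>, so that
      only the discriminant term of \<open>Q\<close> remains.\<close>
    have "0 < Q (vector [- q 1, 2 * q 2])" using q2 by (intro Qpos) (simp add: vec2_eq_iff)
    also have "\<dots> = 4 * (q 2)\<^sup>2 * (q 0 - (q 1)\<^sup>2 / (4 * q 2))"
      using q2 by (simp add: Qz field_simps power2_eq_square)
    finally show ?thesis using q2 by (simp add: zero_less_mult_iff)
  qed
  define s e d where "s = sqrt (q 2)" and "e = q 1 / (2 * s)" and "d = sqrt (q 0 - (q 1)\<^sup>2 / (4 * q 2))"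
  have s: "s > 0" "s\<^sup>2 = q 2" and d: "d > 0" "d\<^sup>2 = q 0 - (q 1)\<^sup>2 / (4 * q 2)"
    using q2 disc by (simp_all add: s_def d_def)
  have e: "2 * s * e = q 1" "e\<^sup>2 = (q 1)\<^sup>2 / (4 * q 2)"
    using s by (simp_all add: e_def power_divide power_mult_distrib)
  \<comment> \<open>The real and imaginary parts are the two squares of the completed form of
    \<open>Q\<close>.\<close>
  define \<phi> where "\<phi> z = Complex (s * z $ 1 + e * z $ 2) (d * z $ 2)" for z :: "real^2"
  define \<psi> where "\<psi> u = (vector [(Re u - e * Im u / d) / s, Im u / d] :: real^2)" for u
  have pp: "\<phi> (\<psi> u) = u" "\<psi> (\<phi> z) = z" for u z
    using s(1) d(1) by (simp_all add: \<phi>_def \<psi>_def complex_eq_iff vec2_eq_iff)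
  have norm\<phi>: "(cmod (\<phi> z))\<^sup>2 = Q z" for z
  proof -
    have "(cmod (\<phi> z))\<^sup>2 = s\<^sup>2 * (z $ 1)\<^sup>2 + (2 * s * e) * z $ 1 * z $ 2 + (e\<^sup>2 + d\<^sup>2) * (z $ 2)\<^sup>2"
      unfolding cmod_power2 \<phi>_def complex.sel by (simp add: power2_eq_square algebra_simps)
    then show ?thesis by (simp only: s e d Qz) (simp add: algebra_simps)
  qed
  have QA: "Q (A z) = Q z" for z
  proof -
    have "Q (A z) ^ b = Q z ^ b"
      using stabilizerD(2)[OF stabilizer0D(1)[OF A(1)], of z] c by (simp add: f)
    then show ?thesis using b Qnn power_eq_imp_eq_base[of "Q (A z)" b "Q z"] by simp
  qed
  have lin\<phi>: "linear \<phi>" and lin\<psi>: "linear \<psi>"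
    by (intro linearI; simp add: \<phi>_def \<psi>_def complex_eq_iff vec2_eq_iff algebra_simps add_divide_distrib diff_divide_distrib)+
  define M where "M u = \<phi> (A (\<psi> u))" for u
  have linM: "linear M"
    unfolding M_def using linear_compose[OF linear_compose[OF lin\<psi> A(2)] lin\<phi>] by (simp add: o_def)
  have nM: "(cmod (M u))\<^sup>2 = (cmod u)\<^sup>2" for u
    by (simp add: M_def norm\<phi> QA) (simp add: norm\<phi>[symmetric] pp)
  define m n where "m = M 1" and "n = M \<i>"
  have Mu: "M u = Re u *\<^sub>R m + Im u *\<^sub>R n" for u
  proof -
    have "u = Re u *\<^sub>R 1 + Im u *\<^sub>R \<i>" by (simp add: complex_eq_iff)
    then have "M u = M (Re u *\<^sub>R 1 + Im u *\<^sub>R \<i>)" by (rule arg_cong)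
    also have "\<dots> = Re u *\<^sub>R m + Im u *\<^sub>R n"
      by (simp only: linear_add[OF linM] linear_scale[OF linM] m_def n_def)
    finally show ?thesis .
  qed
  have m1: "(Re m)\<^sup>2 + (Im m)\<^sup>2 = 1" using nM[of 1] by (simp add: m_def cmod_power2)
  have n1: "(Re n)\<^sup>2 + (Im n)\<^sup>2 = 1" using nM[of \<i>] by (simp add: n_def cmod_power2)
  \<comment> \<open>Polarization: preserving the modulus of \<open>1 + \<i>\<close> as well forces
    the images of 1 and \<open>\<i>\<close> to be orthogonal.\<close>
  have "(Re (m + n))\<^sup>2 + (Im (m + n))\<^sup>2 = 2"
    using nM[of "1 + \<i>"] Mu[of "1 + \<i>"] by (simp add: cmod_power2)
  then have orth: "Re m * Re n + Im m * Im n = 0"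
    using m1 n1 by (simp add: power2_sum)
  have detM: "Re m * Im n - Im m * Re n = det2 A"
  proof -
    define a11 a12 a21 a22 where "a11 = A (axis 1 1) $ 1" and "a12 = A (axis 2 1) $ 1"
      and "a21 = A (axis 1 1) $ 2" and "a22 = A (axis 2 1) $ 2"
    have Az: "A z $ 1 = z $ 1 * a11 + z $ 2 * a12" "A z $ 2 = z $ 1 * a21 + z $ 2 * a22" for z
      by (subst linear_vec2[OF A(2), of z], simp add: a11_def a12_def a21_def a22_def)+
    \<comment> \<open>Naming the inverses of \<open>s\<close> and \<open>d\<close> turns the
      invariance of the determinant under conjugation into a polynomial identity modulo
      \<open>s * i = 1\<close> and \<open>d * j = 1\<close>.\<close>
    define i j where "i = inverse s" and "j = inverse d"
    have ij: "s * i = 1" "d * j = 1" using s(1) d(1) by (simp_all add: i_def j_def)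
    have M: "Re (M u) = s * (A (\<psi> u) $ 1) + e * (A (\<psi> u) $ 2)" "Im (M u) = d * (A (\<psi> u) $ 2)" for u
      by (simp_all add: M_def \<phi>_def)
    have \<psi>: "\<psi> u $ 1 = (Re u - e * (Im u * j)) * i" "\<psi> u $ 2 = Im u * j" for u
      by (simp_all add: \<psi>_def i_def j_def divide_inverse)
    have "Re m = s * (i * a11) + e * (i * a21)" "Im m = d * (i * a21)"
      "Re n = s * (- e * j * i * a11 + j * a12) + e * (- e * j * i * a21 + j * a22)"
      "Im n = d * (- e * j * i * a21 + j * a22)"
      unfolding m_def n_def M Az \<psi> by simp_all
    then have "Re m * Im n - Im m * Re n = a11 * a22 - a21 * a12"
      using ij by algebra
    then show ?thesis
      unfolding det2_def a11_def[symmetric] a12_def[symmetric] a21_def[symmetric] a22_def[symmetric] .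
  qed
  have n_eq: "n = \<i> * m"
  proof -
    \<comment> \<open>Lagrange's identity: for orthogonal unit vectors the determinant is 1 or -1.
      Positivity leaves 1, and then \<open>n\<close> is \<open>m\<close> turned by a right
      angle.\<close>
    have "(Re m * Im n - Im m * Re n)\<^sup>2 + (Re m * Re n + Im m * Im n)\<^sup>2 =
      ((Re m)\<^sup>2 + (Im m)\<^sup>2) * ((Re n)\<^sup>2 + (Im n)\<^sup>2)"
      by (simp add: power2_eq_square algebra_simps)
    then have "(det2 A)\<^sup>2 = 1" by (simp add: detM orth m1 n1)
    then have D: "Re m * Im n - Im m * Re n = 1" using det by (simp add: detM power2_eq_1_iff)
    have "Im n = ((Re m)\<^sup>2 + (Im m)\<^sup>2) * Im n" by (simp add: m1)
    also have "\<dots> = Re m * (Re m * Im n - Im m * Re n) + Im m * (Re m * Re n + Im m * Im n)"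
      by (simp add: power2_eq_square algebra_simps)
    finally have i: "Im n = Re m" by (simp add: D orth)
    have "Re n = ((Re m)\<^sup>2 + (Im m)\<^sup>2) * Re n" by (simp add: m1)
    also have "\<dots> = Re m * (Re m * Re n + Im m * Im n) - Im m * (Re m * Im n - Im m * Re n)"
      by (simp add: power2_eq_square algebra_simps)
    finally have "Re n = - Im m" by (simp add: D orth)
    then show ?thesis using i by (simp add: complex_eq_iff)
  qed
  obtain \<theta> where \<theta>: "m = cis \<theta>"
  proof -
    have "cmod m = 1" using m1 by (simp add: cmod_def)
    then have "m = cis (Arg m)" using cis_Arg[of m] by (cases "m = 0") (auto simp: sgn_div_norm)
    then show thesis by (rule that)
  qed
  have Mm: "M u = cis \<theta> * u" for u
    unfolding Mu n_eq \<theta> by (simp add: complex_eq_iff algebra_simps)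
  define B where "B t z = \<psi> (cis (t * \<theta>) * \<phi> z)" for t z
  have lin: "linear (B t)" for t
  proof -
    have "linear (\<lambda>u. cis (t * \<theta>) * u)" by (intro linearI) (simp_all add: algebra_simps)
    from linear_compose[OF linear_compose[OF lin\<phi> this] lin\<psi>] show ?thesis
      by (simp add: B_def[abs_def] o_def)
  qed
  have inv: "B t (B (- t) z) = z" for t z
    by (simp add: B_def pp mult.assoc[symmetric] cis_mult)
  have "Q (B t z) = Q z" for t z
    by (simp add: norm\<phi>[symmetric] B_def pp norm_mult)
  then have "f (B t z) = f z" for t z by (simp add: f)
  then have "B t \<in> stabilizer0 f" for t
    using linear_in_stabilizer0[OF lin[of t] lin[of "- t"]] inv[of t] inv[of "- t"] by simp
  moreover have "continuous_on {0..1} (\<lambda>t. B t z)" for z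
  proof -
    have "continuous_on UNIV \<psi>" using lin\<psi> linear_continuous_on linear_linear by blast
    then show ?thesis unfolding B_def
      by (rule continuous_on_compose2) (auto intro!: continuous_intros)
  qed
  ultimately have "isotopic (stabilizer0 f) r (B 0) (B 1)"
    using lin by (intro isotopic_linear)
  moreover have "B 0 = id" by (simp add: B_def pp fun_eq_iff)
  moreover have "B 1 = A" by (simp add: B_def Mm[symmetric] M_def pp fun_eq_iff)
  ultimately show ?thesis by simp
qed

section \<open>Factorization of forms without real zeros\<close>

lemma map_poly_of_real_mult: "map_poly of_real (p * q) = map_poly of_real p * (map_poly of_real q :: complex poly)"
  by (rule poly_eqI) (simp add: coeff_map_poly coeff_mult)

lemma map_poly_of_real_add: "map_poly of_real (p + q) = map_poly of_real p + (map_poly of_real q :: complex poly)"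
  by (rule poly_eqI) (simp add: coeff_map_poly)

lemma poly_map_poly_of_real: "poly (map_poly of_real p) (of_real x) = (of_real (poly p x) :: complex)"
  by (induction p) (simp_all add: map_poly_pCons)

text \<open>A complex root \<open>z\<close> of \<open>g\<close> is not real. The real quadratic
  \<open>m\<close> with roots \<open>z\<close> and \<open>cnj z\<close> divides \<open>g\<close>,
  since the remainder has degree at most 1 and vanishes at a nonreal point. By irreducibility the
  cofactor is constant.\<close>

lemma irreducible_no_root_degree_2:
  fixes g :: "real poly"
  assumes irr: "irreducible g" and no_root: "\<And>x. poly g x \<noteq> 0"
  shows "degree g = 2"
proof -
  let ?C = "map_poly of_real :: real poly \<Rightarrow> complex poly"
  have "g \<noteq> 0" using irr by auto
  have "degree g \<noteq> 0"
    using irr by (metis \<open>g \<noteq> 0\<close> is_unit_iff_degree irreducible_not_unit)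
  moreover have "degree (?C g) = degree g" by (intro degree_map_poly) simp
  ultimately have "\<not> constant (poly (?C g))" using constant_degree by metis
  then obtain z where z: "poly (?C g) z = 0" using fundamental_theorem_of_algebra by blast
  have im: "Im z \<noteq> 0"
  proof
    assume "Im z = 0"
    then have "z = of_real (Re z)" by (simp add: complex_eq_iff)
    then show False using z poly_map_poly_of_real[of g "Re z"] no_root by (metis of_real_eq_0_iff)
  qed
  define m where "m = [:(Re z)\<^sup>2 + (Im z)\<^sup>2, - 2 * Re z, 1:]"
  have dm: "degree m = 2" by (simp add: m_def)
  have mz: "poly (?C m) z = 0"
    by (simp add: m_def map_poly_pCons complex_eq_iff power2_eq_square algebra_simps)
  define r where "r = g mod m"
  have "g = m * (g div m) + r" by (simp add: r_def)
  then have "poly (?C g) z = poly (?C m) z * poly (?C (g div m)) z + poly (?C r) z"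
    by (metis map_poly_of_real_add map_poly_of_real_mult poly_add poly_mult)
  then have rz: "poly (?C r) z = 0" by (simp add: z mz)
  have "degree r < 2 \<or> r = 0" using degree_mod_less[of m g] dm by (auto simp: r_def m_def)
  then have "degree r \<le> 1" by auto
  then have r: "r = [:coeff r 0, coeff r 1:]"
    by (intro poly_eqI) (auto simp: coeff_pCons coeff_eq_0 split: nat.splits)
  define r0 r1 where "r0 = coeff r 0" and "r1 = coeff r 1"
  note r = r[folded r0_def r1_def]
  have "r1 = 0" using rz im unfolding r by (simp add: map_poly_pCons complex_eq_iff)
  then have "r = 0" using rz unfolding r by (simp add: map_poly_pCons)
  then have "g = m * (g div m)" by (simp add: r_def mod_eq_0_iff_dvd)
  then have "is_unit m \<or> is_unit (g div m)" using irr irreducibleD by blast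
  moreover have "\<not> is_unit m" using dm is_unit_iff_degree[of m] by (auto simp: m_def)
  ultimately have unit: "is_unit (g div m)" by blast
  then have "g div m \<noteq> 0" by auto
  then have "degree (g div m) = 0" using is_unit_iff_degree unit by blast
  then show ?thesis using \<open>g = m * (g div m)\<close> \<open>g div m \<noteq> 0\<close> dm degree_mult_eq[of m "g div m"] by (auto simp: m_def)
qed

text \<open>The homogenization of the polynomial \<open>[:c, b, 1:]\<close> in the variable
  \<open>z $ 1 / z $ 2\<close>.\<close>

definition monic_form :: "real \<Rightarrow> real \<Rightarrow> real^2 \<Rightarrow> real" where
  "monic_form b c z = (z $ 1)\<^sup>2 + b * z $ 1 * z $ 2 + c * (z $ 2)\<^sup>2"

text \<open>Absence of real roots means negative discriminant, and completing the square gives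
  definiteness. The factor \<open>d\<close> will absorb the leading constant of a product.\<close>

lemma pos_def_scaled_monic_form:
  assumes d: "d > 0" and no_root: "\<And>x. poly [:c, b, 1:] x \<noteq> 0"
  shows "pos_def_form (\<lambda>z. d * monic_form b c z)"
proof -
  have disc: "b\<^sup>2 < 4 * c"
  proof (rule ccontr)
    assume "\<not> b\<^sup>2 < 4 * c"
    then have "(sqrt (b\<^sup>2 - 4 * c))\<^sup>2 = b\<^sup>2 - 4 * c" by simp
    then have "poly [:c, b, 1:] ((sqrt (b\<^sup>2 - 4 * c) - b) / 2) = 0"
      by (simp add: power2_eq_square field_simps)
    then show False using no_root by blast
  qed
  have "monic_form b c z > 0" if "z \<noteq> 0" for z
  proof -
    have eq: "monic_form b c z = (z $ 1 + b / 2 * z $ 2)\<^sup>2 + (c - b\<^sup>2 / 4) * (z $ 2)\<^sup>2"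
      by (simp add: monic_form_def power2_eq_square algebra_simps)
    show ?thesis
    proof (cases "z $ 2 = 0")
      case True
      then show ?thesis using that by (simp add: eq vec2_eq_iff)
    next
      case False
      then have "(c - b\<^sup>2 / 4) * (z $ 2)\<^sup>2 > 0" using disc by (intro mult_pos_pos) simp_all
      then show ?thesis unfolding eq by (simp add: add_nonneg_pos)
    qed
  qed
  moreover have "homogeneous_poly 2 (\<lambda>z. d * monic_form b c z)"
    unfolding homogeneous_poly_def
    by (intro exI[of _ "\<lambda>i. d * (if i = 0 then c else if i = 1 then b else 1)"])
      (use d in \<open>auto simp: numeral_2_eq_2 monic_form_def algebra_simps\<close>)
  ultimately show ?thesis using d by (simp add: pos_def_form_def)
qed

text \<open>Dehomogenizing gives a polynomial \<open>q\<close> without real roots, whose prime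
  factors are therefore quadratic, and monic because they are normalized. Homogenizing the prime
  factorization of \<open>q\<close> gives that of \<open>f\<close>.\<close>

lemma definite_form_factorization:
  assumes f: "homogeneous_poly p f" and p: "p \<ge> 1" and definite: "\<And>z. z \<noteq> 0 \<Longrightarrow> f z \<noteq> 0"
  obtains a k b c \<beta> where "a \<noteq> 0" "k \<ge> 1"
    "\<And>j x. j < (k::nat) \<Longrightarrow> poly [:c j, b j, 1:] x \<noteq> (0::real)" "\<And>j. j < k \<Longrightarrow> \<beta> j \<ge> (1::nat)"
    "\<And>i j. i < k \<Longrightarrow> j < k \<Longrightarrow> b i = b j \<Longrightarrow> c i = c j \<Longrightarrow> i = j"
    "\<And>z. f z = a * (\<Prod>j<k. monic_form (b j) (c j) z ^ \<beta> j)"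
proof -
  obtain u where u: "f z = (\<Sum>i\<le>p. u i * (z $ 1) ^ i * (z $ 2) ^ (p - i))" for z
    using f unfolding homogeneous_poly_def by blast
  define q where "q = (\<Sum>i\<le>p. monom (u i) i)"
  have q: "poly q x = f (vector [x, 1])" for x
    by (simp add: q_def u poly_sum poly_monom)
  have q_nz: "poly q x \<noteq> 0" for x
    unfolding q by (rule definite) (simp add: vec2_eq_iff)
  have f1: "f (vector [x, 0]) = u p * x ^ p" for x
  proof -
    have "f (vector [x, 0]) = (\<Sum>i\<le>p. if i = p then u p * x ^ p else 0)"
      unfolding u by (rule sum.cong) auto
    then show ?thesis by simp
  qed
  \<comment> \<open>Since \<open>f\<close> does not vanish at (1, 0), the degree does not drop on
    dehomogenizing; no power of \<open>z $ 2\<close> splits off.\<close>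
  have up: "u p \<noteq> 0" using definite[of "vector [1, 0]"] by (simp add: f1 vec2_eq_iff)
  have coeffq: "coeff q i = (if i \<le> p then u i else 0)" for i
    by (simp add: q_def coeff_sum)
  have degq: "degree q = p"
    by (rule antisym[OF degree_le le_degree]) (auto simp: coeffq up)
  have q0: "q \<noteq> 0" using q_nz by auto
  let ?P = "prime_factors q"
  obtain h where h: "bij_betw h {0..<card ?P} ?P"
    using ex_bij_betw_nat_finite[of ?P] by auto
  define k where "k = card ?P"
  have hP: "h j \<in> ?P" if "j < k" for j using h that by (auto simp: bij_betw_def k_def)
  have prime: "prime (h j)" "h j dvd q" if "j < k" for j
    using hP[OF that] by (simp_all add: in_prime_factors_iff)
  have h_nz: "poly (h j) x \<noteq> 0" if "j < k" for j x
  proof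
    assume "poly (h j) x = 0"
    then have "poly q x = 0" using prime(2)[OF that] by (auto elim: dvdE)
    then show False using q_nz by blast
  qed
  have deg: "degree (h j) = 2" if "j < k" for j
    using prime(1)[OF that] h_nz[OF that]
    by (intro irreducible_no_root_degree_2 prime_elem_imp_irreducible) (auto simp: prime_def)
  have lead: "coeff (h j) 2 = 1" if "j < k" for j
  proof -
    have "coeff (h j) 2 \<noteq> 0"
      using deg[OF that] leading_coeff_0_iff[of "h j"] by (cases "h j = 0") auto
    then have "coeff (normalize (h j)) 2 = 1"
      using deg[OF that] by simp
    then show ?thesis by (simp only: normalize_prime[OF prime(1)[OF that]])
  qed
  define b c \<beta> where "b j = coeff (h j) 1" and "c j = coeff (h j) 0" and "\<beta> j = multiplicity (h j) q" for j
  have h_eq: "h j = [:c j, b j, 1:]" if "j < k" for j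
  proof (rule poly_eqI)
    fix i
    show "coeff (h j) i = coeff [:c j, b j, 1:] i"
      using lead[OF that] deg[OF that] coeff_eq_0[of "h j" i]
      by (cases i; cases "i - 1"; cases "i - 2") (auto simp: b_def c_def numeral_2_eq_2 coeff_pCons split: nat.splits)
  qed
  have prod: "(\<Prod>j<k. h j ^ \<beta> j) = normalize q"
    using prod.reindex_bij_betw[OF h, of "\<lambda>g. g ^ multiplicity g q"] prod_prime_factors[OF q0]
    by (simp add: \<beta>_def k_def atLeast0LessThan)
  have norm_q: "smult (u p) (normalize q) = q"
    using up degq by (intro poly_eqI) (simp add: normalize_poly_eq_map_poly coeff_map_poly coeffq)
  \<comment> \<open>This degree count distributes the factor \<open>(z $ 2) ^ p\<close> as one
    square for each quadratic factor.\<close>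
  have p_sum: "p = (\<Sum>j<k. 2 * \<beta> j)"
  proof -
    have "p = degree (\<Prod>j<k. h j ^ \<beta> j)" using degq up norm_q by (metis prod degree_smult_eq)
    also have "\<dots> = (\<Sum>j<k. degree (h j ^ \<beta> j))"
    proof (intro degree_prod_eq_sum_degree ballI)
      fix j assume "j \<in> {..<k}"
      then have "degree (h j) = 2" by (intro deg) simp
      then show "h j ^ \<beta> j \<noteq> 0" by auto
    qed
    also have "\<dots> = (\<Sum>j<k. 2 * \<beta> j)"
    proof (rule sum.cong)
      fix j assume "j \<in> {..<k}"
      then have "degree (h j) = 2" by (intro deg) simp
      moreover from this have "h j \<noteq> 0" by auto
      ultimately show "degree (h j ^ \<beta> j) = 2 * \<beta> j" by (simp add: degree_power_eq)
    qed simp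
    finally show ?thesis .
  qed
  have pow_p: "x ^ p = (\<Prod>j<k. (x\<^sup>2) ^ \<beta> j)" for x :: real
    unfolding p_sum by (simp add: power_sum power_mult)
  \<comment> \<open>The line \<open>z $ 2 = 0\<close> is invisible to \<open>q\<close> and is
    treated separately, by leading coefficients.\<close>
  have feq: "f z = u p * (\<Prod>j<k. monic_form (b j) (c j) z ^ \<beta> j)" for z
  proof (cases "z $ 2 = 0")
    case True
    then have "z = vector [z $ 1, 0]" by (simp add: vec2_eq_iff)
    then have "f z = u p * (z $ 1) ^ p" using f1 by metis
    then show ?thesis using True by (simp add: pow_p monic_form_def)
  next
    case False
    define x where "x = z $ 1 / z $ 2"
    have "z = z $ 2 *\<^sub>R vector [x, 1]" using False by (simp add: vec2_eq_iff x_def)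
    then have "f z = (z $ 2) ^ p * poly q x"
      using homogeneous_poly_scaleR[OF f, of "z $ 2" "vector [x, 1]"] by (simp add: q)
    also have "poly q x = u p * (\<Prod>j<k. poly (h j) x ^ \<beta> j)"
    proof -
      have "poly q x = poly (smult (u p) (\<Prod>j<k. h j ^ \<beta> j)) x" unfolding prod norm_q ..
      then show ?thesis by (simp add: poly_prod)
    qed
    also have "(z $ 2) ^ p * (u p * (\<Prod>j<k. poly (h j) x ^ \<beta> j)) =
      u p * (\<Prod>j<k. ((z $ 2)\<^sup>2 * poly (h j) x) ^ \<beta> j)"
      by (simp add: pow_p power_mult_distrib prod.distrib)
    also have "(\<Prod>j<k. ((z $ 2)\<^sup>2 * poly (h j) x) ^ \<beta> j) = (\<Prod>j<k. monic_form (b j) (c j) z ^ \<beta> j)"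
    proof (rule prod.cong)
      fix j assume "j \<in> {..<k}"
      then have "poly (h j) x = c j + x * (b j + x)" by (simp add: h_eq)
      moreover have "z $ 1 = x * z $ 2" using False by (simp add: x_def)
      ultimately have "(z $ 2)\<^sup>2 * poly (h j) x = monic_form (b j) (c j) z"
        by (simp add: monic_form_def power2_eq_square algebra_simps)
      then show "((z $ 2)\<^sup>2 * poly (h j) x) ^ \<beta> j = monic_form (b j) (c j) z ^ \<beta> j" by simp
    qed simp
    finally show ?thesis .
  qed
  have k1: "k \<ge> 1" using p p_sum by (cases k) auto
  have \<beta>1: "\<beta> j \<ge> 1" if "j < k" for j
    using prime[OF that] q0 by (simp add: \<beta>_def Suc_le_eq prime_multiplicity_gt_zero_iff)
  have no_root: "poly [:c j, b j, 1:] x \<noteq> 0" if "j < k" for j x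
    using h_nz[OF that, of x] h_eq[OF that] by simp
  have dist: "i = j" if "i < k" "j < k" "b i = b j" "c i = c j" for i j
  proof -
    have "h i = h j" using that h_eq by simp
    then show ?thesis using h that by (auto simp: bij_betw_def inj_on_def k_def)
  qed
  show ?thesis by (rule that[OF up k1 no_root \<beta>1 dist feq])
qed

text \<open>The number \<open>k\<close> of prime factors decides: \<open>k = 1\<close> is the
  claimed power, and \<open>k \<ge> 2\<close> would be a product of distinct definite forms.\<close>

lemma definite_cases:
  assumes f: "homogeneous_poly p f" and p: "p \<ge> 1" and definite: "\<And>z. z \<noteq> 0 \<Longrightarrow> f z \<noteq> 0"
    and not_prod: "\<not> prod_distinct_definite f"
  obtains a Q n where "a \<noteq> 0" "n \<ge> 1" "pos_def_form Q" "\<And>z. f z = a * Q z ^ n"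
proof -
  obtain a k b c \<beta> where a: "a \<noteq> 0" and k: "k \<ge> 1"
    and no_root: "\<And>j x. j < (k::nat) \<Longrightarrow> poly [:c j, b j, 1:] x \<noteq> (0::real)"
    and \<beta>: "\<And>j. j < k \<Longrightarrow> \<beta> j \<ge> (1::nat)"
    and dist: "\<And>i j. i < k \<Longrightarrow> j < k \<Longrightarrow> b i = b j \<Longrightarrow> c i = c j \<Longrightarrow> i = j"
    and feq: "\<And>z. f z = a * (\<Prod>j<k. monic_form (b j) (c j) z ^ \<beta> j)"
  proof (rule definite_form_factorization[OF f p])
    show "f z \<noteq> 0" if "z \<noteq> 0" for z by (rule definite[OF that])
  qed (rule that)
  \<comment> \<open>A product of definite forms may carry only a sign, so
    \<open>\<bar>a\<bar>\<close> is moved into the first factor as a root of order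
    \<open>\<beta> 0\<close>.\<close>
  define d where "d j = (if j = 0 then \<bar>a\<bar> powr (1 / \<beta> 0) else 1)" for j :: nat
  define Q where "Q j z = d j * monic_form (b j) (c j) z" for j and z :: "real^2"
  have d: "d j > 0" for j using a by (simp add: d_def)
  have Q: "pos_def_form (Q j)" if "j < k" for j
    using pos_def_scaled_monic_form[OF d no_root[OF that]] by (simp add: Q_def[abs_def])
  show ?thesis
  proof (cases "k = 1")
    case True
    have "pos_def_form (\<lambda>z. 1 * monic_form (b 0) (c 0) z)"
      using pos_def_scaled_monic_form[OF zero_less_one no_root] True by simp
    then show ?thesis using that[OF a \<beta>[of 0]] feq True by (simp add: lessThan_Suc)
  next
    case False
    have "\<not> (\<lambda>z. Q i z / Q j z) constant_on (UNIV - {0})" if ij: "i < k" "j < k" "i \<noteq> j" for i j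
    proof
      assume "(\<lambda>z. Q i z / Q j z) constant_on (UNIV - {0})"
      then obtain y where y: "\<And>z. z \<noteq> 0 \<Longrightarrow> Q i z / Q j z = y" unfolding constant_on_def by auto
      have y': "Q i z = y * Q j z" if "z \<noteq> 0" for z
        using y[OF that] Q[OF ij(2)] that by (auto simp: pos_def_form_def field_simps)
      have y1: "d i = y * d j"
        using y'[of "vector [1, 0]"] by (simp add: Q_def monic_form_def vec2_eq_iff)
      have "d i * monic_form (b i) (c i) z = d i * monic_form (b j) (c j) z" if "z \<noteq> 0" for z
        using y'[OF that] by (simp add: Q_def y1)
      then have m: "monic_form (b i) (c i) z = monic_form (b j) (c j) z" if "z \<noteq> 0" for z
        using d[of i] that by simp
      \<comment> \<open>The scale factors agree after testing at (1, 0); the points (0, 1) and (1,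
        1) then recover the two remaining coefficients.\<close>
      have "c i = c j" using m[of "vector [0, 1]"] by (simp add: monic_form_def vec2_eq_iff)
      moreover have "b i = b j" using m[of "vector [1, 1]"] \<open>c i = c j\<close> by (simp add: monic_form_def vec2_eq_iff)
      ultimately show False using dist ij by blast
    qed
    moreover have "f z = sgn a * (\<Prod>j<k. Q j z ^ \<beta> j)" for z
    proof -
      have "(\<Prod>j<k. d j ^ \<beta> j) = d 0 ^ \<beta> 0"
        using k by (subst prod.remove[of _ 0]) (auto simp: d_def)
      also have "\<dots> = \<bar>a\<bar>"
        using a \<beta>[of 0] k by (simp add: d_def powr_power)
      finally have "(\<Prod>j<k. Q j z ^ \<beta> j) = \<bar>a\<bar> * (\<Prod>j<k. monic_form (b j) (c j) z ^ \<beta> j)"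
        by (simp add: Q_def power_mult_distrib prod.distrib)
      then show ?thesis by (simp add: feq mult.assoc[symmetric] sgn_mult_abs)
    qed
    moreover have "k \<ge> 2" using k False by simp
    moreover have "sgn a \<in> {1, -1}" using a by (simp add: sgn_real_def)
    ultimately have "prod_distinct_definite f"
      unfolding prod_distinct_definite_def using Q \<beta> by blast
    then show ?thesis using not_prod by blast
  qed
qed

lemma C0_isotopic_imp_C1:
  assumes f: "homogeneous_poly p f" and p: "p \<ge> 1" and not_prod: "\<not> prod_distinct_definite f"
    and h: "h \<in> stabilizer f" "isotopic (stabilizer f) 0 id h"
  shows "isotopic (stabilizer f) r id h"
proof -
  let ?A = "frechet_derivative h (at 0)"
  note A = derivative_in_stabilizer0[OF f h(1)]
  have iso: "isotopic (stabilizer0 f) 0 id ?A" by (rule C0_isotopic_imp_linear_part[OF f h])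
  have det: "det2 ?A > 0" by (rule isotopic_det_pos[OF A(1) iso])
  have "isotopic (stabilizer0 f) r id ?A"
  proof (cases "\<exists>v. v \<noteq> 0 \<and> f v = 0")
    case True
    then obtain v where v: "v \<noteq> 0" "f v = 0" by blast
    obtain l where l: "l > 0" "?A v = l *\<^sub>R v"
      by (rule isotopic_preserves_zero_rays[OF f iso v(2,1)]) (rule that)
    show ?thesis by (rule isotopic_positive_eigenvalue[OF f p A(2,1) det v(1) l(2,1)])
  next
    case False
    then have definite: "f z \<noteq> 0" if "z \<noteq> 0" for z using that by blast
    obtain a Q n where a: "a \<noteq> 0" "n \<ge> 1" "pos_def_form Q" and feq: "\<And>z. f z = a * Q z ^ n"
    proof (rule definite_cases[OF f p _ not_prod])
      show "f z \<noteq> 0" if "z \<noteq> 0" for z by (rule definite[OF that])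
    qed (rule that)
    show ?thesis by (rule isotopic_definite_square[OF feq a A(2,1) det])
  qed
  then have "isotopic (stabilizer f) r id ?A"
    using isotopic_mono[OF _ stabilizer0_subset order_refl] by blast
  then show ?thesis using isotopic_derivative[OF f h(1)] isotopic_trans by blast
qed

section \<open>Rotation along level curves\<close>

text \<open>Expressed through axis vectors so that the continuity and \<open>C_k_on\<close> rules
  for sums and scalar multiples apply.\<close>

definition rot :: "real \<Rightarrow> real^2 \<Rightarrow> real^2" where
  "rot a z = (cos a * z $ 1 - sin a * z $ 2) *\<^sub>R axis 1 1 + (sin a * z $ 1 + cos a * z $ 2) *\<^sub>R axis 2 1"

lemma rot_nth: "rot a z $ 1 = cos a * z $ 1 - sin a * z $ 2" "rot a z $ 2 = sin a * z $ 1 + cos a * z $ 2"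
  by (simp_all add: rot_def axis_def)

lemma rot_rot: "rot a (rot b z) = rot (a + b) z"
  by (simp add: vec2_eq_iff rot_nth cos_add sin_add algebra_simps)

lemma rot_scaleR: "rot a (c *\<^sub>R z) = c *\<^sub>R rot a z"
  by (simp add: vec2_eq_iff rot_nth algebra_simps)

lemma rot_0 [simp]: "rot 0 z = z" and rot_pi [simp]: "rot pi z = - z" and rot_zero [simp]: "rot a 0 = 0"
  by (simp_all add: vec2_eq_iff rot_nth)

lemma rot_eq_0_iff [simp]: "rot a z = 0 \<longleftrightarrow> z = 0"
  using rot_rot[of "- a" a z] by auto

lemma norm_vec2: "(norm z)\<^sup>2 = (z $ 1)\<^sup>2 + (z $ 2)\<^sup>2" for z :: "real^2"
  by (simp add: norm_vec_def L2_set_def UNIV_2)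

lemma norm_rot [simp]: "norm (rot a z) = norm z"
proof -
  have "(norm (rot a z))\<^sup>2 = ((cos a)\<^sup>2 + (sin a)\<^sup>2) * ((z $ 1)\<^sup>2 + (z $ 2)\<^sup>2)"
    unfolding norm_vec2 rot_nth by algebra
  then have "(norm (rot a z))\<^sup>2 = (norm z)\<^sup>2" by (simp add: norm_vec2)
  then show ?thesis by (simp add: power2_eq_iff_nonneg)
qed

lemma powr_inverse_power:
  assumes "x > 0" "p \<ge> (1::nat)"
  shows "(x powr (1 / p)) ^ p = x" "(x powr (- (1 / p))) ^ p = inverse x"
  using assms by (simp_all add: powr_power powr_minus power_inverse)

lemma power_mult_powr:
  assumes "c > 0" "x > 0" "p \<ge> (1::nat)"
  shows "(c ^ p * x) powr (1 / p) = c * x powr (1 / p)"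
    "(c ^ p * x) powr (- (1 / p)) = inverse c * x powr (- (1 / p))"
proof -
  have "(c ^ p) powr (1 / p) = c" "(c ^ p) powr (- (1 / p)) = inverse c"
    using assms by (simp_all add: powr_realpow[symmetric] powr_powr powr_minus)
  then show "(c ^ p * x) powr (1 / p) = c * x powr (1 / p)"
    "(c ^ p * x) powr (- (1 / p)) = inverse c * x powr (- (1 / p))"
    using assms by (simp_all add: powr_mult)
qed

text \<open>The symmetry \<open>even\<close> makes the half turn along level curves equal to
  \<open>-id\<close>.\<close>

locale positive_form =
  fixes p :: nat and g :: "real^2 \<Rightarrow> real"
  assumes p: "p \<ge> 1" and hom: "homogeneous_poly p g" and pos: "\<And>z. z \<noteq> 0 \<Longrightarrow> g z > 0"
    and even: "\<And>z. g (- z) = g z"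
begin

text \<open>The rotation by \<open>a\<close>, followed by the projection along rays back to the level set of \<open>g\<close>. Unless \<open>g\<close> is
  a power of a quadratic form, it is not differentiable at the origin.\<close>

definition level_rot :: "real \<Rightarrow> real^2 \<Rightarrow> real^2" where
  "level_rot a z = (g z powr (1 / p) * g (rot a z) powr (- (1 / p))) *\<^sub>R rot a z"

lemma g_scaleR: "g (c *\<^sub>R z) = c ^ p * g z"
  by (rule homogeneous_poly_scaleR[OF hom])

lemma g_zero [simp]: "g 0 = 0"
  using g_scaleR[of 0 0] p by (cases p) simp_all

lemma g_pos_iff [simp]: "g z > 0 \<longleftrightarrow> z \<noteq> 0" and g_eq_0_iff [simp]: "g z = 0 \<longleftrightarrow> z = 0"
  using pos[of z] by (cases "z = 0"; simp)+

lemma level_rot_zero [simp]: "level_rot a 0 = 0"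
  by (simp add: level_rot_def)

lemma level_rot_0 [simp]: "level_rot 0 z = z"
proof (cases "z = 0")
  case False
  then have "g z powr (1 / p) * g z powr (- (1 / p)) = 1"
    using pos[OF False] by (simp flip: powr_add)
  then show ?thesis by (simp only: level_rot_def rot_0 scaleR_one)
qed simp

lemma level_rot_pi [simp]: "level_rot pi z = - z"
  using level_rot_0[of z] by (cases "z = 0") (simp_all add: level_rot_def even)

lemma g_level_rot [simp]: "g (level_rot a z) = g z"
proof (cases "z = 0")
  case False
  then have "g z > 0" "g (rot a z) > 0" using pos by simp_all
  then show ?thesis
    using p by (simp add: level_rot_def g_scaleR power_mult_distrib powr_inverse_power)
qed simp

text \<open>\<open>g\<close> is unchanged by the inner map, and homogeneity makes its scale factor
  \<open>c\<close> cancel.\<close>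

lemma level_rot_level_rot: "level_rot a (level_rot b z) = level_rot (a + b) z"
proof (cases "z = 0")
  case False
  define c where "c = g z powr (1 / p) * g (rot b z) powr (- (1 / p))"
  have c: "c > 0" using False by (simp add: c_def)
  have e: "level_rot b z = c *\<^sub>R rot b z" by (simp add: level_rot_def c_def)
  have G: "g (rot (a + b) z) > 0" using pos False by simp
  have "level_rot a (level_rot b z) =
      (g z powr (1 / p) * (c ^ p * g (rot (a + b) z)) powr (- (1 / p))) *\<^sub>R c *\<^sub>R rot (a + b) z"
    unfolding level_rot_def[of a] g_level_rot unfolding e rot_scaleR rot_rot g_scaleR ..
  also have "(c ^ p * g (rot (a + b) z)) powr (- (1 / p)) = inverse c * g (rot (a + b) z) powr (- (1 / p))"
    by (rule power_mult_powr(2)[OF c G p])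
  also have "(g z powr (1 / p) * (inverse c * g (rot (a + b) z) powr (- (1 / p)))) *\<^sub>R c *\<^sub>R rot (a + b) z
      = level_rot (a + b) z"
    using c by (simp add: level_rot_def)
  finally show ?thesis .
qed simp

lemma g_compose_C_k_on:
  assumes "open S" "C_k_on k S u" "C_k_on k S v"
  shows "C_k_on k S (\<lambda>z. g (u z *\<^sub>R axis 1 1 + v z *\<^sub>R axis 2 1))"
proof -
  obtain a where a: "g z = (\<Sum>i\<le>p. a i * (z $ 1) ^ i * (z $ 2) ^ (p - i))" for z
    using hom unfolding homogeneous_poly_def by blast
  have "C_k_on k S (\<lambda>z. \<Sum>i\<le>p. a i * u z ^ i * v z ^ (p - i))"
    by (intro C_k_on_sum C_k_on_mult C_k_on_const C_k_on_power assms)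
  then show ?thesis by (simp add: a axis_def)
qed

lemma g_C_k_on: "open S \<Longrightarrow> C_k_on k S g"
  using g_compose_C_k_on[OF _ C_k_on_nth C_k_on_nth, of S k 1 2] by (simp flip: vec2_expand)

text \<open>Near the origin the angle vanishes, which restores smoothness there.\<close>

lemma smooth_level_rot:
  "smooth (\<lambda>z. level_rot (c * flat_exp 0 (t * g z - 1)) z)"
  unfolding smooth_def C_k_eq_C_k_on
proof
  fix k
  let ?h = "\<lambda>z. level_rot (c * flat_exp 0 (t * g z - 1)) z"
  \<comment> \<open>On \<open>?U\<close> the angle is 0 and the map is the identity; on
    \<open>?V\<close> all arguments of \<open>powr\<close> are positive. The two cover the plane
    because \<open>g 0 = 0\<close>.\<close>
  let ?U = "{z. t * g z < 1}" and ?V = "- {0} :: (real^2) set"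
  have U: "open ?U"
    using homogeneous_poly_continuous[OF hom, of UNIV] by (intro open_Collect_less continuous_intros) auto
  have V: "open ?V" by auto
  have "?h z = z" if "z \<in> ?U" for z using that by (simp add: flat_exp_def)
  then have "C_k_on k ?U ?h"
    using C_k_on_cong[OF U, of ?h "\<lambda>z. z" k] C_k_on_bounded_linear[OF U bounded_linear_ident] by blast
  moreover have "C_k_on k ?V ?h"
  proof -
    define al where "al z = c * flat_exp 0 (t * g z - 1)" for z
    have "C_k_on k ?V (\<lambda>z. t * g z + (- 1))"
      by (intro C_k_on_add C_k_on_mult C_k_on_const g_C_k_on V)
    then have "C_k_on k ?V (\<lambda>z. flat_exp 0 (t * g z - 1))"
      by (intro C_k_on_compose_real[OF V _ C_k_on_flat_exp]) simp_all
    then have al: "C_k_on k ?V al"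
      unfolding al_def by (intro C_k_on_mult C_k_on_const V)
    have cs: "C_k_on k ?V (\<lambda>z. cos (al z))" "C_k_on k ?V (\<lambda>z. sin (al z))"
      using C_k_on_compose_real[OF V _ conjunct1[OF C_k_on_cos_sin] al]
        C_k_on_compose_real[OF V _ conjunct2[OF C_k_on_cos_sin] al] by simp_all
    define u v where "u z = cos (al z) * z $ 1 + (- 1) * (sin (al z) * z $ 2)"
      and "v z = sin (al z) * z $ 1 + cos (al z) * z $ 2" for z :: "real^2"
    have u: "C_k_on k ?V u" and v: "C_k_on k ?V v"
      unfolding u_def v_def by (intro C_k_on_add C_k_on_mult C_k_on_const C_k_on_nth cs V)+
    have r: "rot (al z) z = u z *\<^sub>R axis 1 1 + v z *\<^sub>R axis 2 1" for z
      by (simp add: rot_def u_def v_def)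
    have "C_k_on k ?V (\<lambda>z. g z powr (1 / p))"
      by (rule C_k_on_compose_real[OF V _ C_k_on_powr g_C_k_on[OF V]]) auto
    moreover have "C_k_on k ?V (\<lambda>z. g (rot (al z) z) powr (- (1 / p)))"
      unfolding r by (rule C_k_on_compose_real[OF V _ C_k_on_powr g_compose_C_k_on[OF V u v]])
        (auto simp flip: r)
    ultimately have "C_k_on k ?V (\<lambda>z. (g z powr (1 / p) * g (rot (al z) z) powr (- (1 / p))) *\<^sub>R
        (u z *\<^sub>R axis 1 1 + v z *\<^sub>R axis 2 1 :: real^2))"
      by (intro C_k_on_scaleR C_k_on_mult C_k_on_add u v V C_k_on_const)
    then show ?thesis unfolding r[symmetric] unfolding al_def level_rot_def .
  qed
  ultimately have "C_k_on k (?U \<union> ?V) ?h" by (rule C_k_on_Un[OF U V])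
  moreover have "?U \<union> ?V = UNIV" by auto
  ultimately show "C_k_on k UNIV ?h" by simp
qed

text \<open>The angle depends on \<open>z\<close> only through \<open>g z\<close>, which the map
  preserves, so the opposite angle inverts it.\<close>

lemma level_rot_in_diffeos:
  "(\<lambda>z. level_rot (c * flat_exp 0 (t * g z - 1)) z) \<in> diffeos"
  by (rule diffeosI[OF smooth_level_rot smooth_level_rot[of "- c" t]])
    (simp_all add: level_rot_level_rot)

text \<open>The parameter \<open>t / (1 - t)\<close> runs from 0 to infinity, so the region
  \<open>t * g z \<le> 1 - t\<close> of angle 0 shrinks to the origin. The second formula is the
  first one with the division by \<open>1 - t\<close> cleared. It yields \<open>pi\<close> at
  \<open>t = 1\<close> and continues past it, which provides open neighbourhoods of the final
  time.\<close>

definition angle :: "real \<Rightarrow> real^2 \<Rightarrow> real" where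
  "angle t z = pi * (if t < 1 then flat_exp 0 (t / (1 - t) * g z - 1)
     else exp (- (1 - t) / (t * g z - (1 - t))))"

text \<open>Each of the two formulas is continuous on its own open set, and they agree on the
  overlap. The union contains all points with \<open>z\<close> nonzero and \<open>t\<close> in the
  unit interval.\<close>

lemma angle_continuous:
  "continuous_on {x. fst x \<noteq> 0 \<and> (snd x < 1 \<or> 1 - snd x < snd x * g (fst x))} (\<lambda>x. angle (snd x) (fst x))"
proof -
  note cg = continuous_on_compose2[OF homogeneous_poly_continuous[OF hom, of UNIV]]
  let ?S = "{x::(real^2) \<times> real. fst x \<noteq> 0 \<and> snd x < 1}"
  let ?T = "{x::(real^2) \<times> real. fst x \<noteq> 0 \<and> 1 - snd x < snd x * g (fst x)}"
  have "open ?S" "open ?T"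
    by (intro open_Collect_conj open_Collect_less open_Collect_neq continuous_intros cg; simp)+
  moreover have "continuous_on ?S (\<lambda>x. angle (snd x) (fst x))"
  proof (rule continuous_on_eq)
    show "continuous_on ?S (\<lambda>x. pi * flat_exp 0 (snd x / (1 - snd x) * g (fst x) - 1))"
      by (intro continuous_intros cg continuous_on_compose2[OF C_k_on_imp_continuous[OF C_k_on_flat_exp]]) auto
  qed (simp add: angle_def)
  moreover have "continuous_on ?T (\<lambda>x. angle (snd x) (fst x))"
  proof (rule continuous_on_eq)
    show "continuous_on ?T (\<lambda>x. pi * exp (- (1 - snd x) / (snd x * g (fst x) - (1 - snd x))))"
      by (intro continuous_intros cg) auto
    show "pi * exp (- (1 - snd x) / (snd x * g (fst x) - (1 - snd x))) = angle (snd x) (fst x)" if "x \<in> ?T" for x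
    proof (cases "snd x < 1")
      case True
      define t where "t = snd x"
      define y where "y = g (fst x)"
      have t: "t < 1" "1 - t < t * y" using True that by (auto simp: t_def y_def)
      have e: "t / (1 - t) * y - 1 = (t * y - (1 - t)) / (1 - t)" using t by (simp add: field_simps)
      have "t / (1 - t) * y - 1 > 0" unfolding e using t by simp
      then have "flat_exp 0 (t / (1 - t) * y - 1) = exp (- inverse (t / (1 - t) * y - 1))"
        by (simp only: flat_exp_def if_True power_0 mult_1)
      also have "- inverse (t / (1 - t) * y - 1) = - (1 - t) / (t * y - (1 - t))"
        unfolding e by (simp only: inverse_divide minus_divide_left)
      finally have "flat_exp 0 (t / (1 - t) * y - 1) = exp (- (1 - t) / (t * y - (1 - t)))" .
      then show ?thesis using True by (simp add: angle_def t_def y_def)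
    qed (simp add: angle_def)
  qed
  ultimately have "continuous_on (?S \<union> ?T) (\<lambda>x. angle (snd x) (fst x))"
    by (rule continuous_on_open_Un)
  moreover have "?S \<union> ?T = {x. fst x \<noteq> 0 \<and> (snd x < 1 \<or> 1 - snd x < snd x * g (fst x))}" by auto
  ultimately show ?thesis by simp
qed

text \<open>The angle has no limit at the origin as \<open>t\<close> tends to 1. A bound uniform in
  the angle gives continuity of the isotopy there. By degree 1 homogeneity it suffices to bound the
  scale factor on the unit circle, where \<open>g\<close> attains a positive minimum and a
  maximum.\<close>

lemma level_rot_bound: "\<exists>C. \<forall>a z. norm (level_rot a z) \<le> C * norm z"
proof -
  let ?S = "sphere (0::real^2) 1"
  have S: "compact ?S" "?S \<noteq> {}" by auto
  have cg: "continuous_on ?S g" by (rule homogeneous_poly_continuous[OF hom])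
  obtain l where l: "l \<in> ?S" "\<And>z. z \<in> ?S \<Longrightarrow> g l \<le> g z" using continuous_attains_inf[OF S cg] by blast
  obtain m where m: "m \<in> ?S" "\<And>z. z \<in> ?S \<Longrightarrow> g z \<le> g m" using continuous_attains_sup[OF S cg] by blast
  have "norm (level_rot a z) \<le> (g m powr (1 / p) * g l powr (- (1 / p))) * norm z" for a z
  proof (cases "z = 0")
    case False
    define w where "w = z /\<^sub>R norm z"
    have w: "w \<in> ?S" "z = norm z *\<^sub>R w" "w \<noteq> 0" using False by (simp_all add: w_def)
    have "rot a w \<in> ?S" using w(1) by simp
    have lpos: "g l > 0" using pos l(1) by (metis dist_0_norm norm_zero mem_sphere zero_neq_one)
    have "level_rot a z = norm z *\<^sub>R level_rot a w"
    proof -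
      have "g z powr (1 / p) = norm z * g w powr (1 / p)"
        using power_mult_powr(1)[of "norm z" "g w" p] False w p by (simp flip: g_scaleR)
      moreover have "g (rot a z) powr (- (1 / p)) = inverse (norm z) * g (rot a w) powr (- (1 / p))"
        using power_mult_powr(2)[of "norm z" "g (rot a w)" p] False w p by (simp flip: g_scaleR rot_scaleR)
      moreover have "rot a z = norm z *\<^sub>R rot a w" by (subst w(2)) (simp only: rot_scaleR)
      ultimately show ?thesis using False by (simp add: level_rot_def)
    qed
    then have "norm (level_rot a z) = norm z * (g w powr (1 / p) * g (rot a w) powr (- (1 / p)))"
      using w(1) by (simp add: level_rot_def)
    also have "\<dots> \<le> norm z * (g m powr (1 / p) * g l powr (- (1 / p)))"
    proof (intro mult_left_mono mult_mono)
      show "g w powr (1 / p) \<le> g m powr (1 / p)"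
        using m(2)[OF w(1)] w(3) by (intro powr_mono2) (simp_all add: less_imp_le)
      show "g (rot a w) powr (- (1 / p)) \<le> g l powr (- (1 / p))"
        using l(2)[OF \<open>rot a w \<in> ?S\<close>] lpos by (intro powr_mono2') simp_all
    qed simp_all
    finally show ?thesis by (simp add: mult_ac)
  qed simp
  then show ?thesis by blast
qed

lemma level_rot_isotopy_continuous:
  "continuous_on (UNIV \<times> {0..1}) (\<lambda>x. level_rot (angle (snd x) (fst x)) (fst x))"
  unfolding continuous_on_eq_continuous_within
proof
  fix x :: "(real^2) \<times> real"
  assume x: "x \<in> UNIV \<times> {0..1}"
  let ?H = "\<lambda>x. level_rot (angle (snd x) (fst x)) (fst x)"
  show "continuous (at x within UNIV \<times> {0..1}) ?H"
  proof (cases "fst x = 0")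
    case True
    obtain C where C: "\<And>a z. norm (level_rot a z) \<le> C * norm z" using level_rot_bound by blast
    have "(?H \<longlongrightarrow> 0) (at x within UNIV \<times> {0..1})"
    proof (rule Lim_null_comparison)
      show "\<forall>\<^sub>F y in at x within UNIV \<times> {0..1}. norm (?H y) \<le> C * norm (fst y)"
        by (rule always_eventually) (simp add: C)
      have "((\<lambda>y. C * norm (fst y)) \<longlongrightarrow> C * norm (fst x)) (at x within UNIV \<times> {0..1})"
        by (intro tendsto_intros)
      then show "((\<lambda>y. C * norm (fst y)) \<longlongrightarrow> 0) (at x within UNIV \<times> {0..1})"
        using True by simp
    qed
    then show ?thesis using True by (simp add: continuous_within)
  next
    case False
    let ?W = "{x. fst x \<noteq> 0 \<and> (snd x < 1 \<or> 1 - snd x < snd x * g (fst x))}"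
    note cg = continuous_on_compose2[OF homogeneous_poly_continuous[OF hom, of UNIV]]
    have "open ?W"
      by (intro open_Collect_conj open_Collect_disj open_Collect_less open_Collect_neq continuous_intros cg; simp)
    moreover have "x \<in> ?W" using x False by (cases "snd x = 1") auto
    moreover have "continuous_on ?W ?H"
    proof -
      have "continuous_on ?W (\<lambda>x. rot (angle (snd x) (fst x)) (fst x))"
        unfolding rot_def by (intro continuous_intros angle_continuous)
      then show ?thesis unfolding level_rot_def
        by (intro continuous_intros cg) auto
    qed
    ultimately have "continuous (at x) ?H" using continuous_on_eq_continuous_at by blast
    then show ?thesis by (rule continuous_at_imp_continuous_within)
  qed
qed

lemma isotopic_uminus: "isotopic (stabilizer g) 0 id uminus"
proof -
  let ?H = "\<lambda>t z. level_rot (angle t z) z"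
  have "?H t \<in> stabilizer g" if "t \<in> {0..1}" for t
  proof (rule stabilizerI)
    show "?H t \<in> diffeos"
    proof (cases "t < 1")
      case True
      then show ?thesis
        using level_rot_in_diffeos[of pi "t / (1 - t)"] by (simp add: angle_def)
    next
      case False
      then have "?H t = uminus" using that by (auto simp: angle_def)
      then show ?thesis
        using diffeosI[of uminus uminus] smooth_linear[OF linear_uminus] by simp
    qed
  qed simp
  moreover have "?H 0 = id" by (simp add: angle_def flat_exp_def fun_eq_iff)
  moreover have "?H 1 = uminus" by (simp add: angle_def fun_eq_iff)
  ultimately show ?thesis
    unfolding isotopic_def using level_rot_isotopy_continuous
    by (intro exI[of _ ?H]) (simp add: case_prod_unfold zero_enat_def)
qed

end

section \<open>Rigidity for several definite factors\<close>

text \<open>The real line is an infinite set of roots of the difference. This transfers polynomial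
  identities for \<open>f\<close> to complex arguments.\<close>

lemma complex_poly_eqI_real:
  fixes P R :: "complex poly"
  assumes "\<And>x. poly P (of_real x) = poly R (of_real x)"
  shows "P = R"
proof (rule ccontr)
  assume "P \<noteq> R"
  then have "finite {z. poly (P - R) z = 0}" by (intro poly_roots_finite) simp
  moreover have "range of_real \<subseteq> {z. poly (P - R) z = 0}" using assms by auto
  ultimately have "finite (range (of_real :: real \<Rightarrow> complex))" using finite_subset by blast
  then show False using finite_imageD[of of_real UNIV] infinite_UNIV_char_0[where 'a = real]
    by (simp add: inj_on_def)
qed

text \<open>The bracket is the squared modulus of \<open>v $ 1 - z * v $ 2\<close>. Thus
  \<open>z\<close> is the root in the upper half plane of the dehomogenized form and determines
  \<open>Q\<close> up to a positive factor.\<close>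

lemma pos_def_form_complex_root:
  assumes "pos_def_form Q"
  obtains q z where "q > 0" "Im z > 0"
    "\<And>v. Q v = q * ((v $ 1)\<^sup>2 - 2 * Re z * v $ 1 * v $ 2 + ((Re z)\<^sup>2 + (Im z)\<^sup>2) * (v $ 2)\<^sup>2)"
proof -
  obtain q :: "nat \<Rightarrow> real" where "\<And>z. Q z = (\<Sum>i\<le>2. q i * (z $ 1) ^ i * (z $ 2) ^ (2 - i))"
    using assms unfolding pos_def_form_def homogeneous_poly_def by blast
  then have "\<And>z. Q z = q 0 * (z $ 2)\<^sup>2 + q 1 * z $ 1 * z $ 2 + q 2 * (z $ 1)\<^sup>2"
    by (simp add: numeral_2_eq_2)
  then obtain q0 q1 q2 where Qz: "\<And>z. Q z = q0 * (z $ 2)\<^sup>2 + q1 * z $ 1 * z $ 2 + q2 * (z $ 1)\<^sup>2" by blast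
  have Qpos: "Q z > 0" if "z \<noteq> 0" for z using assms that by (simp add: pos_def_form_def)
  have q2pos: "q2 > 0" using Qpos[of "axis 1 1"] by (simp add: Qz axis_def vec2_eq_iff)
  define a b where "a = - q1 / (2 * q2)" and "b = q0 / q2 - a\<^sup>2"
  have ab: "q1 = - 2 * a * q2" "q0 = (a\<^sup>2 + b) * q2" using q2pos by (simp_all add: a_def b_def)
  have "0 < Q (vector [a, 1])" by (intro Qpos) (simp add: vec2_eq_iff)
  also have "Q (vector [a, 1]) = b * q2" by (simp add: Qz ab power2_eq_square algebra_simps)
  finally have b: "b > 0" using q2pos by (simp add: zero_less_mult_iff)
  have "Q v = q2 * ((v $ 1)\<^sup>2 - 2 * a * v $ 1 * v $ 2 + (a\<^sup>2 + b) * (v $ 2)\<^sup>2)" for v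
    by (simp add: Qz ab algebra_simps)
  then show ?thesis using that[of q2 "Complex a (sqrt b)"] q2pos b by simp
qed

text \<open>Nonreal roots of a real polynomial come in conjugate pairs, so a nonzero quadratic has
  at most one in the upper half plane. Applied to the fixed points of a Moebius map, this leaves
  only the identity.\<close>

lemma quadratic_roots_upper_half_plane:
  fixes a b c :: real and z w :: complex
  assumes "a * z\<^sup>2 + b * z + c = 0" "a * w\<^sup>2 + b * w + c = 0" "Im z > 0" "Im w > 0" "z \<noteq> w"
  shows "a = 0 \<and> b = 0 \<and> c = 0"
proof -
  have eqs: "a * ((Re z)\<^sup>2 - (Im z)\<^sup>2) + b * Re z + c = 0" "Im z * (2 * a * Re z + b) = 0"
    "a * ((Re w)\<^sup>2 - (Im w)\<^sup>2) + b * Re w + c = 0" "Im w * (2 * a * Re w + b) = 0"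
    using assms(1,2) by (simp_all add: complex_eq_iff power2_eq_square algebra_simps)
  then have b: "b = - 2 * a * Re z" "b = - 2 * a * Re w" using assms(3,4) by auto
  have "a = 0"
  proof (rule ccontr)
    assume a: "a \<noteq> 0"
    then have re: "Re z = Re w" using b by simp
    then have "a * (Im z)\<^sup>2 = a * (Im w)\<^sup>2" using eqs(1,3) by (simp add: algebra_simps)
    then have "Im z = Im w" using a assms(3,4) by (simp add: power2_eq_iff_nonneg)
    then show False using re assms(5) by (simp add: complex_eq_iff)
  qed
  then show ?thesis using b eqs by simp
qed

lemma prod_distinct_definiteE:
  assumes "prod_distinct_definite f"
  obtains k :: nat and Q \<beta> s where "k \<ge> 2" "s \<in> {1, -1}"
    "\<And>j. j < k \<Longrightarrow> pos_def_form (Q j)" "\<And>j. j < k \<Longrightarrow> \<beta> j \<ge> (1::nat)"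
    "\<And>i j. i < k \<Longrightarrow> j < k \<Longrightarrow> i \<noteq> j \<Longrightarrow> \<not> (\<lambda>z. Q i z / Q j z) constant_on (UNIV - {0})"
    "\<And>z. f z = s * (\<Prod>j<k. Q j z ^ \<beta> j)"
proof -
  obtain k :: nat and Q :: "nat \<Rightarrow> real^2 \<Rightarrow> real" and \<beta> :: "nat \<Rightarrow> nat" and s :: real where
    *: "k \<ge> 2 \<and> s \<in> {1, -1} \<and> (\<forall>j<k. pos_def_form (Q j) \<and> \<beta> j \<ge> 1) \<and>
      (\<forall>i<k. \<forall>j<k. i \<noteq> j \<longrightarrow> \<not> (\<lambda>z. Q i z / Q j z) constant_on (UNIV - {0})) \<and>
      (\<forall>z. f z = s * (\<Prod>j<k. Q j z ^ \<beta> j))"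
    using assms unfolding prod_distinct_definite_def by (elim exE) (rule that)
  show ?thesis by (rule that[of k s Q \<beta>]) (use * in simp_all)
qed

text \<open>As a Moebius map \<open>-id\<close> is trivial, so the roots alone do not tell it from
  \<open>id\<close>. But fixing two roots forces every linear map of the path to be a scalar
  \<open>a t\<close>, and a continuous \<open>a\<close> from 1 to -1 has a zero, contradicting
  invertibility.\<close>

lemma not_C1_isotopic_uminus:
  assumes f: "homogeneous_poly p f" and prod: "prod_distinct_definite f"
  shows "\<not> isotopic (stabilizer f) 1 id uminus"
proof
  assume iso: "isotopic (stabilizer f) 1 id uminus"
  obtain u where u: "f z = (\<Sum>i\<le>p. u i * (z $ 1) ^ i * (z $ 2) ^ (p - i))" and u0: "\<exists>i\<le>p. u i \<noteq> 0" for z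
    using f unfolding homogeneous_poly_def by blast
  \<comment> \<open>The complexification of \<open>f\<close>; \<open>Z\<close> is its set of roots
    in an affine coordinate.\<close>
  define fc :: "complex \<Rightarrow> complex \<Rightarrow> complex" where
    "fc x y = (\<Sum>i\<le>p. of_real (u i) * x ^ i * y ^ (p - i))" for x y
  define Z where "Z = {z. fc z 1 = 0}"
  have "finite Z"
    using polyfun_finite_roots[of "\<lambda>i. complex_of_real (u i)" p] u0 by (simp add: Z_def fc_def)
  obtain k :: nat and Q \<beta> s where k: "k \<ge> 2" and Q: "\<And>j. j < k \<Longrightarrow> pos_def_form (Q j)"
    and \<beta>: "\<And>j. j < k \<Longrightarrow> \<beta> j \<ge> (1::nat)"
    and dist: "\<And>i j. i < k \<Longrightarrow> j < k \<Longrightarrow> i \<noteq> j \<Longrightarrow> \<not> (\<lambda>z. Q i z / Q j z) constant_on (UNIV - {0})"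
    and feq: "\<And>z. f z = s * (\<Prod>j<k. Q j z ^ \<beta> j)"
    by (rule prod_distinct_definiteE[OF prod]) (rule that)
  define R where "R j q z \<longleftrightarrow> q > 0 \<and> Im z > 0 \<and>
    (\<forall>v. Q j v = q * ((v $ 1)\<^sup>2 - 2 * Re z * v $ 1 * v $ 2 + ((Re z)\<^sup>2 + (Im z)\<^sup>2) * (v $ 2)\<^sup>2))" for j q z
  have "\<exists>q z. R j q z" if j: "j < k" for j
    by (rule pos_def_form_complex_root[OF Q[OF j]]) (unfold R_def, blast)
  then obtain q \<zeta> where R: "\<And>j. j < k \<Longrightarrow> R j (q j) (\<zeta> j)" by metis
  have q: "q j > 0" and \<zeta>: "Im (\<zeta> j) > 0" if "j < k" for j
    using R[OF that] by (simp_all add: R_def)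
  have Qq: "Q j v = q j * ((v $ 1)\<^sup>2 - 2 * Re (\<zeta> j) * v $ 1 * v $ 2 +
      ((Re (\<zeta> j))\<^sup>2 + (Im (\<zeta> j))\<^sup>2) * (v $ 2)\<^sup>2)" if "j < k" for j v
    using R[OF that] by (simp add: R_def)
  \<comment> \<open>\<open>Q j\<close> dehomogenized, with roots \<open>\<zeta> j\<close> and its
    conjugate.\<close>
  define m where "m j = smult (of_real (q j)) [:of_real ((Re (\<zeta> j))\<^sup>2 + (Im (\<zeta> j))\<^sup>2), of_real (- 2 * Re (\<zeta> j)), 1::complex:]" for j
  have "(\<Sum>i\<le>p. monom (complex_of_real (u i)) i) = smult (of_real s) (\<Prod>j<k. m j ^ \<beta> j)"
  proof (rule complex_poly_eqI_real)
    fix x :: real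
    have "poly (\<Sum>i\<le>p. monom (complex_of_real (u i)) i) (of_real x) = of_real (f (vector [x, 1]))"
      by (simp add: poly_sum poly_monom u)
    also have "f (vector [x, 1]) = s * (\<Prod>j<k. Q j (vector [x, 1]) ^ \<beta> j)" by (rule feq)
    also have "of_real \<dots> = poly (smult (of_real s) (\<Prod>j<k. m j ^ \<beta> j)) (of_real x)"
    proof -
      have "(\<Prod>j<k. complex_of_real (Q j (vector [x, 1])) ^ \<beta> j) = (\<Prod>j<k. poly (m j) (of_real x) ^ \<beta> j)"
      proof (rule prod.cong)
        fix j assume "j \<in> {..<k}"
        then have "complex_of_real (Q j (vector [x, 1])) = poly (m j) (of_real x)"
          by (simp add: Qq m_def power2_eq_square algebra_simps)
        then show "complex_of_real (Q j (vector [x, 1])) ^ \<beta> j = poly (m j) (of_real x) ^ \<beta> j" by simp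
      qed simp
      then show ?thesis by (simp add: poly_prod)
    qed
    finally show "poly (\<Sum>i\<le>p. monom (complex_of_real (u i)) i) (of_real x) =
      poly (smult (of_real s) (\<Prod>j<k. m j ^ \<beta> j)) (of_real x)" .
  qed
  then have fc_prod: "fc z 1 = of_real s * (\<Prod>j<k. poly (m j) z ^ \<beta> j)" for z
  proof -
    assume *: "(\<Sum>i\<le>p. monom (complex_of_real (u i)) i) = smult (of_real s) (\<Prod>j<k. m j ^ \<beta> j)"
    have "fc z 1 = poly (\<Sum>i\<le>p. monom (complex_of_real (u i)) i) z" by (simp add: fc_def poly_sum poly_monom)
    then show ?thesis unfolding * by (simp add: poly_prod)
  qed
  have root: "\<zeta> j \<in> Z" if "j < k" for j
  proof -
    have "poly (m j) (\<zeta> j) = 0"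
      unfolding m_def poly_smult poly_pCons poly_0
      by (simp add: complex_eq_iff power2_eq_square algebra_simps del: mult_eq_0_iff)
    then have "poly (m j) (\<zeta> j) ^ \<beta> j = 0" using \<beta>[OF that] by simp
    then show ?thesis unfolding Z_def mem_Collect_eq fc_prod
      using that by (auto simp: prod_zero_iff)
  qed
  \<comment> \<open>Equal roots would make the two forms proportional; this is where distinctness of
    the factors is used.\<close>
  have ne: "\<zeta> 0 \<noteq> \<zeta> 1"
  proof
    assume eq: "\<zeta> 0 = \<zeta> 1"
    have k01: "0 < k" "1 < k" using k by auto
    have "Q 0 z / Q 1 z = q 0 / q 1" if "z \<noteq> 0" for z
    proof -
      have "Q 1 z \<noteq> 0" using Q[OF k01(2)] that by (auto simp: pos_def_form_def)
      moreover have "q 1 * Q 0 z = q 0 * Q 1 z" unfolding Qq[OF k01(1)] Qq[OF k01(2)] eq by (rule mult.left_commute)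
      ultimately show ?thesis using q[OF k01(2)] by (simp add: field_simps)
    qed
    then have "(\<lambda>z. Q 0 z / Q 1 z) constant_on (UNIV - {0})" unfolding constant_on_def by auto
    then show False using dist[OF k01] by simp
  qed
  obtain A :: "real \<Rightarrow> real^2 \<Rightarrow> real^2"
    where A: "\<And>t. t \<in> {0..1} \<Longrightarrow> linear (A t)" "\<And>t. t \<in> {0..1} \<Longrightarrow> A t \<in> stabilizer0 f"
    "\<And>v. continuous_on {0..1} (\<lambda>t. A t v)" "A 0 = id" "A 1 = frechet_derivative uminus (at 0)"
    using C1_isotopic_linear_path[OF f iso] by blast
  have A1: "A 1 = uminus"
    unfolding A(5) using frechet_derivative_at[OF linear_imp_has_derivative[OF linear_uminus]] by metis
  define a b c d where "a t = A t (axis 1 1) $ 1" and "b t = A t (axis 2 1) $ 1"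
    and "c t = A t (axis 1 1) $ 2" and "d t = A t (axis 2 1) $ 2" for t
  have cont: "continuous_on {0..1} a" "continuous_on {0..1} b" "continuous_on {0..1} c" "continuous_on {0..1} d"
    unfolding a_def b_def c_def d_def by (intro continuous_intros A(3))+
  have Az: "A t z $ 1 = a t * z $ 1 + b t * z $ 2" "A t z $ 2 = c t * z $ 1 + d t * z $ 2" if "t \<in> {0..1}" for t z
    by (subst linear_vec2[OF A(1)[OF that], of z], simp add: a_def b_def c_def d_def)+
  have inv: "fc (of_real (a t) * z + of_real (b t)) (of_real (c t) * z + of_real (d t)) = fc z 1" if t: "t \<in> {0..1}" for t z
  proof -
    have "(\<Sum>i\<le>p. smult (of_real (u i)) ([:of_real (b t), of_real (a t):] ^ i * [:of_real (d t), of_real (c t):] ^ (p - i)))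
        = (\<Sum>i\<le>p. monom (complex_of_real (u i)) i)" (is "?L = ?R")
    proof (rule complex_poly_eqI_real)
      fix x :: real
      have "poly ?L (of_real x) = of_real (f (A t (vector [x, 1])))"
        by (simp add: poly_sum u Az[OF t] mult.assoc) (simp add: add.commute mult.commute)
      also have "\<dots> = of_real (f (vector [x, 1]))"
        by (simp only: stabilizerD(2)[OF stabilizer0D(1)[OF A(2)[OF t]]])
      also have "\<dots> = poly ?R (of_real x)" by (simp add: poly_sum poly_monom u)
      finally show "poly ?L (of_real x) = poly ?R (of_real x)" .
    qed
    then have "poly ?L z = poly ?R z" by (rule arg_cong)
    then show ?thesis
      by (simp add: fc_def poly_sum poly_monom mult.assoc) (simp add: add.commute mult.commute)
  qed
  have denom: "of_real (c t) * z + of_real (d t) \<noteq> (0::complex)" if t: "t \<in> {0..1}" and z: "Im z > 0" for t z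
  proof
    assume "of_real (c t) * z + of_real (d t) = 0"
    then have "c t = 0" "d t = 0" using z by (auto simp: complex_eq_iff)
    \<comment> \<open>With a vanishing second row, \<open>A t\<close> annihilates a vector
      orthogonal to its first row.\<close>
    then have "A t (vector [b t, - a t]) = 0" by (simp add: vec2_eq_iff Az[OF t] mult.commute)
    then have "vector [b t, - a t] = (0::real^2)" using stabilizer0_nonzero[OF A(2)[OF t]] by blast
    then have "a t = 0" by (simp add: vec2_eq_iff)
    then have "A t (axis 1 1) = 0" using \<open>c t = 0\<close> by (simp add: vec2_eq_iff a_def c_def)
    then show False using stabilizer0_nonzero[OF A(2)[OF t], of "axis 1 1"] by (simp add: vec2_eq_iff axis_def)
  qed
  have fc_hom: "fc (y * x) y = y ^ p * fc x 1" for x y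
  proof -
    have "y ^ p = y ^ i * y ^ (p - i)" if "i \<le> p" for i using that by (simp flip: power_add)
    then show ?thesis by (auto simp: fc_def sum_distrib_left power_mult_distrib intro!: sum.cong)
  qed
  text \<open>The Moebius maps of the path permute the finitely many roots, hence fix each of them.\<close>
  have fixed: "of_real (a t) * \<zeta> j + of_real (b t) = \<zeta> j * (of_real (c t) * \<zeta> j + of_real (d t))"
    if j: "j < k" and t: "t \<in> {0..1}" for j t
  proof -
    define \<mu> where "\<mu> t = (of_real (a t) * \<zeta> j + of_real (b t)) / (of_real (c t) * \<zeta> j + of_real (d t))" for t
    have "continuous_on {0..1} \<mu>"
      unfolding \<mu>_def using denom[OF _ \<zeta>[OF j]] by (intro continuous_intros cont) auto
    moreover have "\<mu> t \<in> Z" if t: "t \<in> {0..1}" for t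
    proof -
      let ?y = "of_real (c t) * \<zeta> j + of_real (d t)"
      have y: "?y \<noteq> 0" by (rule denom[OF t \<zeta>[OF j]])
      have "?y ^ p * fc (\<mu> t) 1 = fc (?y * \<mu> t) ?y" by (simp add: fc_hom)
      also have "?y * \<mu> t = of_real (a t) * \<zeta> j + of_real (b t)" using y by (simp add: \<mu>_def)
      also have "fc \<dots> ?y = 0" unfolding inv[OF t] using root[OF j] by (simp add: Z_def)
      finally show ?thesis using y by (simp add: Z_def)
    qed
    then have "\<mu> ` {0..1} \<subseteq> Z" by (rule image_subsetI)
    then have "finite (\<mu> ` {0..1})" by (rule finite_subset) (rule \<open>finite Z\<close>)
    ultimately have "\<mu> constant_on {0..1}"
      by (rule continuous_finite_range_constant[OF connected_Icc])
    then obtain y where y: "\<mu> t = y" if "t \<in> {0..1}" for t unfolding constant_on_def by blast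
    have "\<mu> t = \<mu> 0" using y[OF t] y[of 0] by simp
    also have "\<dots> = \<zeta> j" by (simp add: \<mu>_def a_def b_def c_def d_def A(4) axis_def)
    finally show ?thesis using denom[OF t \<zeta>[OF j]] by (simp add: \<mu>_def field_simps)
  qed
  have scalar: "a t = d t \<and> b t = 0 \<and> c t = 0" if t: "t \<in> {0..1}" for t
  proof -
    \<comment> \<open>The fixed point equation of the Moebius map, a real quadratic satisfied by two
      points of the upper half plane.\<close>
    have "of_real (c t) * (\<zeta> j)\<^sup>2 + of_real (d t - a t) * \<zeta> j + of_real (- b t) = 0" if "j < k" for j
      using fixed[OF that t] by (simp add: power2_eq_square algebra_simps)
    then have "c t = 0 \<and> d t - a t = 0 \<and> - b t = 0"
      using k \<zeta> ne by (intro quadratic_roots_upper_half_plane[of "c t" "\<zeta> 0" "d t - a t" "- b t" "\<zeta> 1"]) auto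
    then show ?thesis by simp
  qed
  have "a 0 = 1" "a 1 = - 1" by (simp_all add: a_def A(4) A1 axis_def)
  then obtain t where t: "t \<in> {0..1}" "a t = 0"
    using IVT2'[of a 1 0 0] cont(1) by auto
  then have "A t (axis 1 1) = 0"
    using scalar[OF t(1)] by (simp add: vec2_eq_iff a_def c_def)
  then show False using stabilizer0_nonzero[OF A(2)[OF t(1)], of "axis 1 1"] by (simp add: vec2_eq_iff axis_def)
qed

section \<open>The identity components\<close>

text \<open>Multiplication by the sign \<open>s\<close> makes \<open>f\<close> positive and leaves
  its stabilizer unchanged, so the level curve construction applies to
  \<open>s * f z\<close>.\<close>

lemma prod_distinct_definite_positive_form:
  assumes p: "p \<ge> 1" and f: "homogeneous_poly p f" and prod: "prod_distinct_definite f"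
  obtains s where "s \<noteq> 0" "positive_form p (\<lambda>z. s * f z)"
proof -
  obtain k :: nat and Q \<beta> s where s: "s \<in> {1, -1}" and Q: "\<And>j. j < k \<Longrightarrow> pos_def_form (Q j)"
    and feq: "\<And>z. f z = s * (\<Prod>j<k. Q j z ^ \<beta> j)"
    by (rule prod_distinct_definiteE[OF prod]) (rule that)
  have ss: "s * s = 1" using s by auto
  then have sf: "s * f z = (\<Prod>j<k. Q j z ^ \<beta> j)" for z by (simp add: feq flip: mult.assoc)
  have "positive_form p (\<lambda>z. s * f z)"
  proof
    show "homogeneous_poly p (\<lambda>z. s * f z)"
    proof -
      obtain a where "\<exists>i\<le>p. a i \<noteq> 0" "\<And>z. f z = (\<Sum>i\<le>p. a i * (z $ 1) ^ i * (z $ 2) ^ (p - i))"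
        using f unfolding homogeneous_poly_def by blast
      moreover have "s \<noteq> 0" using s by auto
      ultimately show ?thesis unfolding homogeneous_poly_def
        by (intro exI[of _ "\<lambda>i. s * a i"]) (simp add: sum_distrib_left mult.assoc)
    qed
    show "s * f z > 0" if "z \<noteq> 0" for z
      unfolding sf using Q that by (intro prod_pos ballI zero_less_power) (simp add: pos_def_form_def)
    show "s * f (- z) = s * f z" for z
      unfolding sf
    proof (rule prod.cong[OF refl])
      fix j assume "j \<in> {..<k}"
      then have "Q j (- z) = Q j z"
        using homogeneous_poly_scaleR[of 2 "Q j" "- 1" z] Q by (simp add: pos_def_form_def)
      then show "Q j (- z) ^ \<beta> j = Q j z ^ \<beta> j" by simp
    qed
  qed (rule p)
  moreover have "s \<noteq> 0" using s by auto
  ultimately show ?thesis using that by blast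
qed

lemma C0_isotopic_uminus:
  assumes "p \<ge> 1" "homogeneous_poly p f" "prod_distinct_definite f"
  shows "uminus \<in> stabilizer f" "isotopic (stabilizer f) 0 id uminus"
proof -
  obtain s where s: "s \<noteq> 0" and "positive_form p (\<lambda>z. s * f z)"
    by (rule prod_distinct_definite_positive_form[OF assms]) (rule that)
  then interpret positive_form p "\<lambda>z. s * f z" by simp
  have "stabilizer (\<lambda>z. s * f z) = stabilizer f"
    using s by (auto simp: stabilizer_def fun_eq_iff)
  then show iso: "isotopic (stabilizer f) 0 id uminus" using isotopic_uminus by simp
  then show "uminus \<in> stabilizer f" unfolding isotopic_def
    by (elim exE conjE) (drule bspec[of _ _ 1], simp_all)
qed

theorem theorem1p1:
  fixes f :: "real^2 \<Rightarrow> real" and p :: nat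
  assumes "p \<ge> 1" and "homogeneous_poly p f"
  shows "(\<forall>r::enat. 1 \<le> r \<longrightarrow> stabilizer_id f r = stabilizer_id f \<infinity>) \<and>
    (stabilizer_id f 1 \<noteq> stabilizer_id f 0 \<longleftrightarrow> prod_distinct_definite f)"
proof (intro conjI allI impI)
  show "stabilizer_id f r = stabilizer_id f \<infinity>" if "1 \<le> r" for r
    by (rule stabilizer_id_eq_infinity[OF assms(2) that])
  show "stabilizer_id f 1 \<noteq> stabilizer_id f 0 \<longleftrightarrow> prod_distinct_definite f"
  proof
    assume neq: "stabilizer_id f 1 \<noteq> stabilizer_id f 0"
    show "prod_distinct_definite f"
    proof (rule ccontr)
      assume "\<not> prod_distinct_definite f"
      then have "isotopic (stabilizer f) 1 id h \<longleftrightarrow> isotopic (stabilizer f) 0 id h" if "h \<in> stabilizer f" for h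
        using C0_isotopic_imp_C1[OF assms(2,1) _ that] isotopic_mono[OF _ order_refl zero_le] by blast
      then have "stabilizer_id f 1 = stabilizer_id f 0" unfolding stabilizer_id_eq by blast
      with neq show False ..
    qed
  next
    assume prod: "prod_distinct_definite f"
    have "uminus \<in> stabilizer_id f 0"
      using C0_isotopic_uminus[OF assms prod] by (simp add: stabilizer_id_eq)
    moreover have "uminus \<notin> stabilizer_id f 1"
      using not_C1_isotopic_uminus[OF assms(2) prod] by (simp add: stabilizer_id_eq)
    ultimately show "stabilizer_id f 1 \<noteq> stabilizer_id f 0" by blast
  qed
qed

end
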